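(* There is a universal constant $K>0$ such that for all integers $m\ge2$ and $n>m+1$: if the rows $a_1,\dots,a_n$ of $A$ are chosen independently in $S^m$ according to the uniform distribution, then $$\mathbb{E}\big(\ln\mathscr{C}(A)\big)\ \le\ K\ln m ,$$ where $\mathscr{C}$ is the GCC condition number; that is, $\mathbb{E}(\ln\mathscr{C}(A))=O(\ln m)$ (uniformly in $n$).
   Context: $S^m=\{x\in\mathbb{R}^{m+1}: \|x\|=1\}$; $d(a,b)\in[0,\pi]$ is the angular distance on $S^m$. GCC condition number: an element $A=(a_1,\dots,a_n)\in(S^m)^n$ is identified with the $n\times(m+1)$ matrix with rows $a_i$. Its solution set is $\{x\in S^m: \langle a_i,x\rangle\le 0 \text{ for all } i\}$. $A$ is feasible if its solution set is nonempty, and strictly feasible if its solution set has nonempty interior in $S^m$. The set of ill-posed instances $\Sigma_{n,m}$ is the set of feasible instances that are not strictly feasible. On $(S^m)^n$ use the metric $d(A,B)=\max_{1\le i\le n} d(a_i,b_i)$, and put $d(A,\Sigma_{n,m})=\inf\{d(A,B): B\in\Sigma_{n,m}\}$. Then $\mathscr{C}(A)=1/\sin d(A,\Sigma_{n,m})$ (with $\mathscr{C}(A)=\infty$ if $A\in\Sigma_{n,m}$). *)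

theory Defs
  imports "HOL-Probability.Probability"
begin

text \<open>
  Points of \<open>\<real>\<^sup>m\<^sup>+\<^sup>1\<close> are functions \<^typ>\<open>nat \<Rightarrow> real\<close> vanishing beyond index \<open>m\<close>, and
  \<open>S\<^sup>m\<close> is \<^term>\<open>topspace (nsphere m)\<close>. The dimension is not a type, because the constant
  of the theorem is chosen before the dimension.
\<close>

definition dot :: "nat \<Rightarrow> (nat \<Rightarrow> real) \<Rightarrow> (nat \<Rightarrow> real) \<Rightarrow> real" where
  "dot m x y = (\<Sum>j\<le>m. x j * y j)"

definition angular_dist :: "nat \<Rightarrow> (nat \<Rightarrow> real) \<Rightarrow> (nat \<Rightarrow> real) \<Rightarrow> real" where
  "angular_dist m a b = arccos (dot m a b)"

definition instances :: "nat \<Rightarrow> nat \<Rightarrow> (nat \<Rightarrow> nat \<Rightarrow> real) set" where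
  "instances n m = {..<n} \<rightarrow>\<^sub>E topspace (nsphere m)"

definition solution_set :: "nat \<Rightarrow> nat \<Rightarrow> (nat \<Rightarrow> nat \<Rightarrow> real) \<Rightarrow> (nat \<Rightarrow> real) set" where
  "solution_set n m A = {x \<in> topspace (nsphere m). \<forall>i<n. dot m (A i) x \<le> 0}"

definition feasible :: "nat \<Rightarrow> nat \<Rightarrow> (nat \<Rightarrow> nat \<Rightarrow> real) \<Rightarrow> bool" where
  "feasible n m A \<longleftrightarrow> solution_set n m A \<noteq> {}"

definition strictly_feasible :: "nat \<Rightarrow> nat \<Rightarrow> (nat \<Rightarrow> nat \<Rightarrow> real) \<Rightarrow> bool" where
  "strictly_feasible n m A \<longleftrightarrow> nsphere m interior_of solution_set n m A \<noteq> {}"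

definition ill_posed :: "nat \<Rightarrow> nat \<Rightarrow> (nat \<Rightarrow> nat \<Rightarrow> real) set" where
  "ill_posed n m = {A \<in> instances n m. feasible n m A \<and> \<not> strictly_feasible n m A}"

definition instance_dist ::
    "nat \<Rightarrow> nat \<Rightarrow> (nat \<Rightarrow> nat \<Rightarrow> real) \<Rightarrow> (nat \<Rightarrow> nat \<Rightarrow> real) \<Rightarrow> real" where
  "instance_dist n m A B = (MAX i\<in>{..<n}. angular_dist m (A i) (B i))"

definition dist_ill_posed :: "nat \<Rightarrow> nat \<Rightarrow> (nat \<Rightarrow> nat \<Rightarrow> real) \<Rightarrow> real" where
  "dist_ill_posed n m A = (INF B\<in>ill_posed n m. instance_dist n m A B)"

definition gcc_condition :: "nat \<Rightarrow> nat \<Rightarrow> (nat \<Rightarrow> nat \<Rightarrow> real) \<Rightarrow> ereal" where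
  "gcc_condition n m A =
     (if A \<in> ill_posed n m then \<infinity> else 1 / ereal (sin (dist_ill_posed n m A)))"

definition ln_ereal :: "ereal \<Rightarrow> ereal" where
  "ln_ereal x = (if x \<le> 0 then -\<infinity> else if x = \<infinity> then \<infinity> else ereal (ln (real_of_ereal x)))"

definition radial_projection :: "nat \<Rightarrow> (nat \<Rightarrow> real) \<Rightarrow> nat \<Rightarrow> real" where
  "radial_projection m x = (\<lambda>i. if i \<le> m then x i / sqrt (dot m x x) else 0)"

text \<open>
  The normalised surface measure of \<open>S\<^sup>m\<close>, obtained as the cone measure: the law of \<open>x / \<parallel>x\<parallel>\<close>
  for \<open>x\<close> uniform with respect to Lebesgue measure in the punctured unit ball. The push-forward
  lives on the whole function space and is concentrated on \<open>S\<^sup>m\<close>, to which it is restricted.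
\<close>

definition uniform_sphere :: "nat \<Rightarrow> (nat \<Rightarrow> real) measure" where
  "uniform_sphere m =
     restrict_space
       (distr
          (uniform_measure (\<Pi>\<^sub>M i\<in>{..m}. lborel)
             {x \<in> space (\<Pi>\<^sub>M i\<in>{..m}. lborel). 0 < dot m x x \<and> dot m x x \<le> 1})
          borel (radial_projection m))
       (topspace (nsphere m))"

lemma prob_space_uniform_sphere: "prob_space (uniform_sphere m)"
proof -
  let ?L = "\<Pi>\<^sub>M i\<in>{..m}. (lborel :: real measure)"
  define B where "B = {x \<in> space ?L. 0 < dot m x x \<and> dot m x x \<le> 1}"
  let ?U = "uniform_measure ?L B"
  interpret product_sigma_finite "\<lambda>_::nat. lborel :: real measure" ..
  have dot_meas: "(\<lambda>x. dot m x x) \<in> borel_measurable ?L"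
    unfolding dot_def by measurable
  have B: "B \<in> sets ?L"
    unfolding B_def using dot_meas by measurable
  have le1: "\<bar>x i\<bar> \<le> 1" if "x \<in> B" "i \<le> m" for x i
  proof -
    have "x i * x i \<le> dot m x x"
      unfolding dot_def using that(2) by (intro member_le_sum) auto
    then show ?thesis
      using that(1) abs_square_le_1[of "x i"] by (auto simp: B_def power2_eq_square)
  qed
  have fin: "emeasure ?L B \<noteq> \<infinity>"
  proof -
    have "B \<subseteq> (\<Pi>\<^sub>E i\<in>{..m}. {-1..1})"
    proof
      fix x assume x: "x \<in> B"
      then have "x \<in> extensional {..m}" by (simp add: B_def space_PiM PiE_iff)
      moreover have "x i \<in> {-1..1}" if "i \<in> {..m}" for i
        using le1[OF x, of i] that by (simp add: abs_le_iff)
      ultimately show "x \<in> (\<Pi>\<^sub>E i\<in>{..m}. {-1..1})" by (simp add: PiE_iff)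
    qed
    then have "emeasure ?L B \<le> emeasure ?L (\<Pi>\<^sub>E i\<in>{..m}. {-1..1})"
      by (rule emeasure_mono) (auto intro!: sets_PiM_I_finite)
    also have "\<dots> = (\<Prod>i\<in>{..m}. emeasure lborel {-1..1::real})"
      by (rule emeasure_PiM) auto
    also have "\<dots> < \<infinity>" by (simp add: ennreal_prod_eq_top less_top[symmetric] del: prod_constant)
    finally show ?thesis by simp
  qed
  have pos: "emeasure ?L B \<noteq> 0"
  proof -
    let ?c = "1 / real (Suc m)"
    have "(\<Pi>\<^sub>E i\<in>{..m}. {0<..?c}) \<subseteq> B"
    proof
      fix x assume x: "x \<in> (\<Pi>\<^sub>E i\<in>{..m}. {0<..?c})"
      then have xi: "0 < x i" "x i \<le> ?c" if "i \<le> m" for i using that by auto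
      have "0 < dot m x x" unfolding dot_def
        by (intro sum_pos) (use xi in auto)
      moreover have "dot m x x \<le> (\<Sum>j\<le>m. ?c)" unfolding dot_def
      proof (intro sum_mono)
        fix j assume "j \<in> {..m}"
        then have j: "0 < x j" "x j \<le> ?c" using xi by auto
        have "?c \<le> 1" by simp
        with j have "x j * x j \<le> ?c * 1" by (intro mult_mono) linarith+
        then show "x j * x j \<le> ?c" by simp
      qed
      ultimately show "x \<in> B" using x by (auto simp: B_def space_PiM PiE_iff)
    qed
    then have "emeasure ?L (\<Pi>\<^sub>E i\<in>{..m}. {0<..?c}) \<le> emeasure ?L B"
      using B by (rule emeasure_mono)
    moreover have "emeasure ?L (\<Pi>\<^sub>E i\<in>{..m}. {0<..?c}) = (\<Prod>i\<in>{..m}. emeasure lborel {0<..?c})"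
      by (rule emeasure_PiM) auto
    moreover have "(\<Prod>i\<in>{..m}. emeasure lborel {0<..?c}) \<noteq> 0"
      by (simp add: ennreal_power)
    ultimately show ?thesis by (metis le_zero_eq)
  qed
  have U: "prob_space ?U" using pos fin by (rule prob_space_uniform_measure)
  have rp: "radial_projection m \<in> borel_measurable ?U"
  proof -
    have "radial_projection m \<in> borel_measurable ?L"
    proof (rule measurable_coordinatewise_then_product)
      fix i
      show "(\<lambda>x. radial_projection m x i) \<in> borel_measurable ?L"
        unfolding radial_projection_def using dot_meas by (cases "i \<le> m") simp_all
    qed
    then show ?thesis by (simp cong: measurable_cong_sets)
  qed
  have S: "topspace (nsphere m) \<in> sets borel"
  proof -
    have "topspace (nsphere m) = {x. (\<Sum>i\<le>m. (x i)\<^sup>2) = 1 \<and> (\<forall>i>m. x i = 0)}"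
      by (auto simp: nsphere)
    also have "\<dots> \<in> sets borel"
    proof -
      have "closed {x::nat\<Rightarrow>real. (\<Sum>i\<le>m. (x i)\<^sup>2) = 1}"
        by (intro closed_Collect_eq continuous_intros continuous_on_product_coordinates)
      moreover have "closed {x::nat\<Rightarrow>real. \<forall>i>m. x i = 0}"
        by (intro closed_Collect_all closed_Collect_imp closed_Collect_eq continuous_intros
              continuous_on_product_coordinates open_Collect_const)
      ultimately show ?thesis by (auto simp: Collect_conj_eq)
    qed
    finally show ?thesis .
  qed
  let ?D = "distr ?U borel (radial_projection m)"
  have D: "prob_space ?D" using U rp by (rule prob_space.prob_space_distr)
  have in_S: "radial_projection m x \<in> topspace (nsphere m)" if "x \<in> B" for x
  proof -
    have "dot m x x > 0" using that by (auto simp: B_def)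
    then have "(\<Sum>i\<le>m. (radial_projection m x i)\<^sup>2) = 1"
      by (simp add: radial_projection_def power_divide flip: sum_divide_distrib)
         (simp add: dot_def power2_eq_square)
    then show ?thesis by (auto simp: nsphere radial_projection_def)
  qed
  have "emeasure ?D (topspace (nsphere m)) = emeasure ?U (radial_projection m -` topspace (nsphere m) \<inter> space ?U)"
    using rp S by (rule emeasure_distr)
  also have "\<dots> = emeasure ?L B / emeasure ?L B"
  proof -
    have "B \<inter> (radial_projection m -` topspace (nsphere m) \<inter> space ?U) = B"
      using in_S by (auto simp: B_def)
    then show ?thesis
      using B measurable_sets[OF rp S] by simp
  qed
  also have "\<dots> = 1" using pos fin by (simp add: ennreal_divide_self less_top)
  finally have 1: "emeasure ?D (topspace (nsphere m)) = 1" .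
  show ?thesis
    unfolding uniform_sphere_def B_def[symmetric]
    by (rule prob_space_restrict_space) (use S 1 in auto)
qed

lemma dot_in_cball:
  assumes "a \<in> topspace (nsphere m)" "b \<in> topspace (nsphere m)"
  shows "\<bar>dot m a b\<bar> \<le> 1"
proof -
  have "(dot m a b)\<^sup>2 \<le> (\<Sum>j\<le>m. (a j)\<^sup>2) * (\<Sum>j\<le>m. (b j)\<^sup>2)"
    unfolding dot_def by (rule Cauchy_Schwarz_ineq_sum)
  also have "\<dots> = 1" using assms by (simp add: nsphere)
  finally show ?thesis by (simp add: abs_square_le_1)
qed

lemma ill_posed_nonempty:
  assumes "m \<ge> 1" "n \<ge> 2"
  shows "ill_posed n m \<noteq> {}"
proof -
  define e :: "nat \<Rightarrow> nat \<Rightarrow> real" where "e k = (\<lambda>j. if j = k then 1 else 0)" for k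
  have e: "e k \<in> topspace (nsphere m)" if "k \<le> m" for k
    using that by (auto simp: nsphere e_def if_distrib[where f="\<lambda>x. x\<^sup>2"] cong: if_cong)
  have ne: "(\<lambda>j. - e 0 j) \<in> topspace (nsphere m)"
    using e[of 0] by (auto simp: nsphere)
  define A where "A = (\<lambda>i\<in>{..<n}. if i = 0 then (\<lambda>j. - e 0 j) else e 0)"
  have A: "A \<in> instances n m" using e[of 0] ne by (auto simp: instances_def A_def)
  have dot_e: "dot m (e 0) x = x 0" "dot m (\<lambda>j. - e 0 j) x = - x 0" for x
    by (auto simp: dot_def e_def if_distrib[where f="\<lambda>a. a * _"] sum_negf cong: if_cong)
  have sol: "solution_set n m A = {x \<in> topspace (nsphere m). x 0 = 0}"
  proof -
    have "(\<forall>i<n. dot m (A i) x \<le> 0) \<longleftrightarrow> x 0 = 0" for x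
    proof
      assume "\<forall>i<n. dot m (A i) x \<le> 0"
      from this[rule_format, of 0] this[rule_format, of 1]
      show "x 0 = 0" using assms(2) by (simp add: A_def dot_e)
    qed (auto simp: A_def dot_e)
    then show ?thesis by (auto simp: solution_set_def)
  qed
  have "e 1 \<in> solution_set n m A" using e[of 1] assms(1) by (simp add: sol) (simp add: e_def)
  then have feas: "feasible n m A" by (auto simp: feasible_def)
  have "nsphere m interior_of solution_set n m A = {}"
  proof (rule ccontr)
    assume "\<not> ?thesis"
    then obtain U x where U: "openin (nsphere m) U" "x \<in> U" "U \<subseteq> solution_set n m A"
      by (auto simp: interior_of_def)
    then have x: "x \<in> topspace (nsphere m)" "x 0 = 0" by (auto simp: sol)
    define g where "g t = (\<lambda>j. if j = 0 then sin t else cos t * x j)" for t :: real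
    have sumg: "(\<Sum>j\<le>m. (g t j)\<^sup>2) = 1" for t
    proof -
      have "(\<Sum>j\<le>m. (g t j)\<^sup>2) = (\<Sum>j\<le>m. (sin t)\<^sup>2 * (if j = 0 then 1 else 0) + (cos t)\<^sup>2 * (x j)\<^sup>2)"
        using x(2) by (intro sum.cong) (auto simp: g_def power_mult_distrib)
      also have "\<dots> = (sin t)\<^sup>2 + (cos t)\<^sup>2 * (\<Sum>j\<le>m. (x j)\<^sup>2)"
        by (simp add: sum.distrib flip: sum_distrib_left)
      finally show ?thesis using x(1) by (simp add: nsphere)
    qed
    have "continuous_map euclidean (nsphere m) g"
    proof -
      have "continuous_map euclidean (powertop_real UNIV) g"
        by (auto simp: continuous_map_componentwise_UNIV g_def intro!: continuous_intros)
      moreover have "g t j = 0" if "j > m" for t j using that x(1) by (auto simp: g_def nsphere)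
      ultimately show ?thesis using sumg by (auto simp: nsphere continuous_map_in_subtopology)
    qed
    from openin_continuous_map_preimage[OF this U(1)]
    have "open {t. g t \<in> U}" by simp
    moreover have "g 0 = x" using x(2) by (auto simp: g_def)
    ultimately obtain d where d: "d > 0" "\<And>t. \<bar>t\<bar> < d \<Longrightarrow> g t \<in> U"
      using U(2) unfolding open_dist by (force simp: dist_real_def)
    define t where "t = min (d / 2) 1"
    have t: "0 < t" "t < d" "t < pi" using d(1) pi_gt3 by (auto simp: t_def min_def)
    then have "g t \<in> solution_set n m A" using d(2)[of t] U(3) by auto
    then have "sin t = 0" by (simp add: sol g_def)
    then show False using sin_gt_zero[of t] t by auto
  qed
  then show ?thesis using A feas by (auto simp: ill_posed_def strictly_feasible_def)
qed

text \<open>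
  By the next lemma \<open>ln C(A) \<ge> 0\<close>, so the expectation can be taken as a nonnegative integral
  after applying \<^const>\<open>e2ennreal\<close>, which truncates nothing.
\<close>

lemma one_le_gcc_condition:
  assumes "m \<ge> 1" "n \<ge> 2" "A \<in> instances n m"
  shows "1 \<le> gcc_condition n m A"
proof -
  have bd: "0 \<le> instance_dist n m A B \<and> instance_dist n m A B \<le> pi" if "B \<in> ill_posed n m" for B
  proof -
    have "instance_dist n m A B \<in> (\<lambda>i. angular_dist m (A i) (B i)) ` {..<n}"
      unfolding instance_dist_def using assms(2) by (intro Max_in) (auto simp: lessThan_empty_iff)
    then obtain i where i: "i < n" "instance_dist n m A B = arccos (dot m (A i) (B i))"
      by (auto simp: angular_dist_def)
    have "\<bar>dot m (A i) (B i)\<bar> \<le> 1"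
      using that assms(3) i(1) by (intro dot_in_cball) (auto simp: ill_posed_def instances_def)
    then show ?thesis using i(2) by (auto simp: arccos_lbound arccos_ubound abs_le_iff)
  qed
  obtain B where B: "B \<in> ill_posed n m" using ill_posed_nonempty[OF assms(1,2)] by auto
  have "0 \<le> dist_ill_posed n m A"
    unfolding dist_ill_posed_def using B bd by (intro cINF_greatest) auto
  moreover have "dist_ill_posed n m A \<le> pi"
    unfolding dist_ill_posed_def using B bd
    by (intro cINF_lower2[OF _ B]) (auto intro!: bdd_belowI[of _ 0])
  ultimately have "0 \<le> sin (dist_ill_posed n m A)" by (intro sin_ge_zero)
  then show ?thesis
    by (cases "sin (dist_ill_posed n m A) = 0") (auto simp: gcc_condition_def one_ereal_def)
qed

end

theory Submission
  imports Defs
begin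

text \<open>
  Put \<open>M = m + 1\<close> and \<open>t(A) = max\<^sub>p min\<^sub>i \<langle>a\<^sub>i, p\<rangle>\<close>, the maximum over \<open>p \<in> S\<^sup>m\<close>. Moving every row by an angle
  at most \<open>\<delta>\<close> changes each \<open>\<langle>a\<^sub>i, p\<rangle>\<close> by at most \<open>\<delta>\<close>, and \<open>t = 0\<close> on ill-posed instances. So an
  instance within \<open>\<delta>\<close> of an ill-posed one has \<open>\<bar>t(A)\<bar> \<le> \<delta>\<close>, and it suffices to bound the probability
  of this event by \<open>C M\<^sup>7 \<surd>\<delta>\<close> with \<open>C\<close> independent of \<open>m\<close> and \<open>n\<close>; summing this tail over
  \<open>\<delta> = 4\<^sup>-\<^sup>k\<close> gives the expectation. In what follows \<open>t\<close> is not named: a finite net of the sphere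
  replaces the maximum over \<open>p\<close>, at the cost of constants, so that all events are finite Boolean
  combinations of half-space conditions (\<open>near_ill_posed\<close>).

  The probability bound rests on an averaging argument (\<open>near_ill_posed_critical_row\<close>). Suppose
  \<open>-\<delta> \<le> t(A) \<le> \<delta>\<close>, and let \<open>P\<^sub>i\<close> be the set of directions \<open>q\<close> with \<open>\<langle>a\<^sub>j, q\<rangle> \<ge> -\<delta>\<close> for all
  \<open>j \<noteq> i\<close>. If every \<open>i\<close> had a \<open>q\<^sub>i \<in> P\<^sub>i\<close> with \<open>\<langle>a\<^sub>i, q\<^sub>i\<rangle> > 2n\<delta>\<close>, then the normalised average of the
  \<open>q\<^sub>i\<close> would have inner product larger than \<open>\<delta>\<close> with every row. Hence some row \<open>a\<^sub>i\<close> satisfies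
  \<open>\<langle>a\<^sub>i, q\<rangle> \<le> 2n\<delta>\<close> for all \<open>q \<in> P\<^sub>i\<close>, while \<open>\<langle>a\<^sub>i, p\<rangle> \<ge> -\<delta>\<close> for some \<open>p \<in> P\<^sub>i\<close>. As \<open>P\<^sub>i\<close> does not depend
  on \<open>a\<^sub>i\<close>, this says that \<open>a\<^sub>i\<close> lies in a shell of thickness \<open>O(n\<delta>)\<close> around a convex boundary that is
  independent of it. The argument treats
  feasible and infeasible instances alike.

  Such a shell has measure \<open>O(M\<^sup>3 n \<delta>)\<close> (\<open>emeasure_shell_le\<close>). In the unit ball, split it into pieces
  on each of which one coordinate direction crosses the boundary at a definite angle. A piece
  contains no long chord in its direction, so its translates by multiples of a short step \<open>\<tau>\<close> are
  disjoint; about \<open>1 / (M\<tau>)\<close> of them fit into a ball of radius \<open>1 + 1/M\<close>, whose volume exceeds that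
  of the unit ball by a factor of at most \<open>3\<close>.

  Summing over the rows bounds the probability by \<open>O(n\<^sup>2 M\<^sup>3 \<delta>)\<close>, which is enough for \<open>n = O(M\<^sup>2)\<close>. For larger
  \<open>n\<close>, a net of \<open>exp (O(M ln M))\<close> caps, each holding all \<open>n\<close> rows with probability at most \<open>(3/4)\<^sup>n\<close>, shows
  that \<open>t(A) \<ge> -\<delta>\<close> is exponentially unlikely, and the geometric mean of the two bounds is uniform
  in \<open>n\<close> (\<open>tail_bounds_combine\<close>).
\<close>

section \<open>Lebesgue measure in coordinates\<close>

lemma emeasure_PiM_lborel_affine:
  fixes c :: real and t :: "'i \<Rightarrow> real"
  assumes "finite I" "c \<noteq> 0" and X: "X \<in> sets (PiM I (\<lambda>_. lborel))"
  shows "emeasure (PiM I (\<lambda>_. lborel)) X =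
    ennreal (\<bar>c\<bar> ^ card I) *
      emeasure (PiM I (\<lambda>_. lborel)) {x \<in> space (PiM I (\<lambda>_. lborel)). (\<lambda>i\<in>I. t i + c * x i) \<in> X}"
proof -
  interpret product_sigma_finite "\<lambda>_::'i. lborel :: real measure" ..
  let ?L = "PiM I (\<lambda>_. lborel :: real measure)"
  let ?T = "\<lambda>x. \<lambda>i\<in>I. t i + c * x i"
  have T: "?T \<in> measurable ?L ?L"
    by (rule measurable_restrict) simp
  have vim: "?T -` X \<inter> space ?L = {x \<in> space ?L. ?T x \<in> X}" for X by auto
  have line: "ennreal \<bar>c\<bar> * emeasure lborel ((\<lambda>x. s + c * x) -` A) = emeasure lborel A"
    if "A \<in> sets borel" for s A
    using that assms(2)
    by (subst (2) lborel_real_affine[of c s])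
       (simp_all add: emeasure_density_const emeasure_distr)
  have "scale_measure (ennreal (\<bar>c\<bar> ^ card I)) (distr ?L ?L ?T) = ?L"
  proof (rule PiM_eqI)
    fix A :: "'i \<Rightarrow> real set"
    assume A: "\<And>i. i \<in> I \<Longrightarrow> A i \<in> sets lborel"
    have pre: "{x \<in> space ?L. ?T x \<in> Pi\<^sub>E I A} = (\<Pi>\<^sub>E i\<in>I. (\<lambda>x. t i + c * x) -` A i)"
      by (auto simp: space_PiM PiE_iff extensional_def)
    have m: "(\<lambda>x. t i + c * x) -` A i \<in> sets borel" if "i \<in> I" for i
      using A[OF that] measurable_sets_borel[of "\<lambda>x. t i + c * x" borel "A i"] by simp
    have "emeasure (distr ?L ?L ?T) (Pi\<^sub>E I A) = emeasure ?L (\<Pi>\<^sub>E i\<in>I. (\<lambda>x. t i + c * x) -` A i)"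
      using A assms(1) unfolding pre[symmetric] vim[symmetric]
      by (intro emeasure_distr[OF T] sets_PiM_I_finite) auto
    also have "\<dots> = (\<Prod>i\<in>I. emeasure lborel ((\<lambda>x. t i + c * x) -` A i))"
      using assms(1) m by (intro emeasure_PiM) auto
    finally have "emeasure (scale_measure (ennreal (\<bar>c\<bar> ^ card I)) (distr ?L ?L ?T)) (Pi\<^sub>E I A) =
        (\<Prod>i\<in>I. ennreal \<bar>c\<bar> * emeasure lborel ((\<lambda>x. t i + c * x) -` A i))"
      by (simp add: prod.distrib ennreal_power)
    also have "\<dots> = (\<Prod>i\<in>I. emeasure lborel (A i))"
      using A by (intro prod.cong) (auto simp: line)
    finally show "emeasure (scale_measure (ennreal (\<bar>c\<bar> ^ card I)) (distr ?L ?L ?T)) (Pi\<^sub>E I A) =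
        (\<Prod>i\<in>I. emeasure lborel (A i))" .
  qed (use assms(1) in auto)
  then have "emeasure ?L X = emeasure (scale_measure (ennreal (\<bar>c\<bar> ^ card I)) (distr ?L ?L ?T)) X"
    by simp
  then show ?thesis
    using T X by (simp add: emeasure_distr vim)
qed

abbreviation leb :: "nat \<Rightarrow> (nat \<Rightarrow> real) measure" where
  "leb m \<equiv> \<Pi>\<^sub>M i\<in>{..m}. lborel"

abbreviation punctured_ball :: "nat \<Rightarrow> (nat \<Rightarrow> real) set" where
  "punctured_ball m \<equiv> {x \<in> space (leb m). 0 < dot m x x \<and> dot m x x \<le> 1}"

abbreviation sphere_set :: "nat \<Rightarrow> (nat \<Rightarrow> real) set" where
  "sphere_set m \<equiv> topspace (nsphere m)"

lemma dot_commute: "dot m x y = dot m y x"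
  by (simp add: dot_def mult.commute)

lemma dot_self_nonneg: "0 \<le> dot m x x"
  by (simp add: dot_def sum_nonneg)

lemma dot_self_pos:
  assumes "dot m y x \<noteq> 0"
  shows "0 < dot m x x"
proof (rule ccontr)
  assume "\<not> ?thesis"
  then have "(\<Sum>j\<le>m. x j * x j) = 0" using dot_self_nonneg[of m x] by (simp add: dot_def)
  then have "\<forall>j\<in>{..m}. x j * x j = 0" by (subst (asm) sum_nonneg_eq_0_iff) auto
  then show False using assms by (simp add: dot_def)
qed

lemma measurable_dot [measurable]:
  "(\<lambda>x. dot m x p) \<in> borel_measurable (leb m)"
  "(\<lambda>x. dot m x x) \<in> borel_measurable (leb m)"
  unfolding dot_def by measurable

lemma sqrt_dot_eq_L2_set: "sqrt (dot m x x) = L2_set x {..m}"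
  by (simp add: dot_def L2_set_def power2_eq_square)

lemma dot_shift: "j \<le> m \<Longrightarrow> dot m (\<lambda>i. x i + (if i = j then s else 0)) p = dot m x p + s * p j"
  by (simp add: dot_def distrib_right sum.distrib if_distrib[where f="\<lambda>a. a * _"] cong: if_cong)

lemma dot_restrict: "dot m (restrict x {..m}) p = dot m x p"
  by (simp add: dot_def)

lemma sqrt_dot_shift_le:
  assumes "j \<le> m"
  shows "sqrt (dot m (\<lambda>i. x i + (if i = j then s else 0)) (\<lambda>i. x i + (if i = j then s else 0))) \<le> sqrt (dot m x x) + \<bar>s\<bar>"
proof -
  have "L2_set (\<lambda>i. if i = j then s else 0) {..m} = \<bar>s\<bar>"
    using assms by (simp add: L2_set_def if_distrib[where f="\<lambda>x. x\<^sup>2"] cong: if_cong)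
  then show ?thesis
    using L2_set_triangle_ineq[of x "\<lambda>i. if i = j then s else 0" "{..m}"]
    by (simp add: sqrt_dot_eq_L2_set)
qed

text \<open>
  The bound is an equality between volumes of balls, the origin being a null set. The punctured ball
  is the natural unit of volume because the uniform distribution on the sphere is defined from it.
\<close>

lemma emeasure_ball_le:
  assumes "r > 0"
  shows "emeasure (leb m) {x \<in> space (leb m). dot m x x \<le> r\<^sup>2} \<le>
    ennreal (r ^ Suc m) * emeasure (leb m) (punctured_ball m)"
proof -
  interpret product_sigma_finite "\<lambda>_::nat. lborel :: real measure" ..
  let ?B = "{x \<in> space (leb m). dot m x x \<le> r\<^sup>2}"
  let ?Z = "{x \<in> space (leb m). dot m x x = 0}"
  have B: "?B \<in> sets (leb m)" by measurable
  have scaled: "dot m (\<lambda>i\<in>{..m}. 0 + r * x i) (\<lambda>i\<in>{..m}. 0 + r * x i) = r\<^sup>2 * dot m x x" for x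
    by (simp add: dot_def sum_distrib_left power2_eq_square mult_ac)
  have "?Z \<subseteq> (\<Pi>\<^sub>E i\<in>{..m}. {0})"
  proof
    fix x assume x: "x \<in> ?Z"
    then have "\<forall>i\<in>{..m}. x i * x i = 0"
      by (subst sum_nonneg_eq_0_iff[symmetric]) (auto simp: dot_def)
    then show "x \<in> (\<Pi>\<^sub>E i\<in>{..m}. {0})" using x by (auto simp: space_PiM PiE_iff extensional_def)
  qed
  then have "emeasure (leb m) ?Z \<le> emeasure (leb m) (\<Pi>\<^sub>E i\<in>{..m}. {0})"
    by (intro emeasure_mono sets_PiM_I_finite) auto
  also have "\<dots> = (\<Prod>i\<in>{..m}. emeasure lborel {0::real})"
    by (rule emeasure_PiM) auto
  also have "\<dots> = 0" by simp
  finally have Z: "emeasure (leb m) ?Z = 0" by simp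
  have "emeasure (leb m) ?B = ennreal (r ^ Suc m) *
      emeasure (leb m) {x \<in> space (leb m). (\<lambda>i\<in>{..m}. 0 + r * x i) \<in> ?B}"
    using emeasure_PiM_lborel_affine[OF _ _ B, of r "\<lambda>_. 0"] assms by simp
  also have "{x \<in> space (leb m). (\<lambda>i\<in>{..m}. 0 + r * x i) \<in> ?B} = {x \<in> space (leb m). dot m x x \<le> 1}"
    using assms unfolding mem_Collect_eq scaled
    by (auto simp: space_PiM mult_le_cancel_left1)
  also have "emeasure (leb m) \<dots> \<le> emeasure (leb m) (punctured_ball m \<union> ?Z)"
    by (intro emeasure_mono) (use dot_self_nonneg in \<open>auto simp: less_le\<close>)
  also have "\<dots> \<le> emeasure (leb m) (punctured_ball m) + emeasure (leb m) ?Z"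
    by (intro emeasure_subadditive) measurable
  finally show ?thesis using Z by (simp add: mult_left_mono)
qed

section \<open>Thin sets\<close>

text \<open>
  The shifts of \<open>N\<close> by \<open>0, \<tau>, \<dots>, k\<tau>\<close> in the direction \<open>\<sigma> e\<^sub>j\<close> are disjoint, have equal volume and
  lie in the ball of radius \<open>1 + k\<tau>\<close>. With \<open>k\<close> about \<open>1 / (\<tau> (m + 1))\<close> that ball has at most \<open>e \<le> 3\<close> times the
  volume of the unit ball.
\<close>

lemma emeasure_no_long_chord_le:
  assumes j: "j \<le> m" and \<tau>: "\<tau> > 0" and \<sigma>: "\<bar>\<sigma>\<bar> = (1::real)"
    and N: "N \<in> sets (leb m)" "\<And>x. x \<in> N \<Longrightarrow> dot m x x \<le> 1"
    and chord: "\<And>x s. x \<in> N \<Longrightarrow> s \<ge> \<tau> \<Longrightarrow>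
      (\<lambda>i\<in>{..m}. x i + (if i = j then \<sigma> * s else 0)) \<notin> N"
  shows "emeasure (leb m) N \<le> ennreal (3 * real (Suc m) * \<tau>) * emeasure (leb m) (punctured_ball m)"
proof -
  let ?sh = "\<lambda>s x. \<lambda>i\<in>{..m}. x i + (if i = j then s else 0)"
  define k where "k = nat \<lfloor>1 / (\<tau> * real (Suc m))\<rfloor>"
  have k1: "real k * \<tau> * real (Suc m) \<le> 1"
  proof -
    have "real k \<le> 1 / (\<tau> * real (Suc m))" using \<tau> by (simp add: k_def)
    then show ?thesis using \<tau> by (simp add: pos_le_divide_eq mult.assoc)
  qed
  have k2: "1 \<le> real (Suc k) * \<tau> * real (Suc m)"
  proof -
    have "1 / (\<tau> * real (Suc m)) \<le> real (Suc k)" unfolding k_def by linarith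
    then show ?thesis using \<tau> by (simp add: pos_divide_le_eq mult.assoc del: of_nat_Suc)
  qed
  define r where "r = 1 + real k * \<tau>"
  have r: "r > 0" using \<tau> by (simp add: r_def add_pos_nonneg)
  have r3: "r ^ Suc m \<le> 3"
  proof -
    have "r \<le> exp (real k * \<tau>)" by (simp add: r_def)
    then have "r ^ Suc m \<le> exp (real k * \<tau>) ^ Suc m" using r by (intro power_mono) auto
    also have "\<dots> = exp (real (Suc m) * (real k * \<tau>))" by (rule exp_of_nat_mult[symmetric])
    also have "\<dots> \<le> exp 1" using k1 by (simp add: mult_ac)
    also have "\<dots> \<le> 3" by (rule exp_le)
    finally show ?thesis .
  qed
  define T where "T l = {x \<in> space (leb m). ?sh (- \<sigma> * (real l * \<tau>)) x \<in> N}" for l :: nat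
  have affine: "?sh s x = (\<lambda>i\<in>{..m}. (if i = j then s else 0) + 1 * x i)" for s :: real and x
    by (rule restrict_ext) simp
  have emT: "emeasure (leb m) (T l) = emeasure (leb m) N" for l
    unfolding T_def affine
    by (subst emeasure_PiM_lborel_affine[OF _ _ N(1), of 1]) auto
  have setT: "T l \<in> sets (leb m)" for l
  proof -
    have "?sh s \<in> measurable (leb m) (leb m)" for s
      by (rule measurable_restrict) simp
    from measurable_sets[OF this N(1)] show ?thesis
      by (simp add: T_def vimage_def Int_def conj_commute)
  qed
  have sub: "N \<subseteq> space (leb m)" using N(1) by (rule sets.sets_into_space)
  have shsh: "?sh s (?sh u x) = ?sh (s + u) x" for s u :: real and x
    by (rule restrict_ext) simp
  have disj: "x \<notin> T l'" if x: "x \<in> T l" and "l < l'" for x l l'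
  proof
    assume x': "x \<in> T l'"
    define y where "y = ?sh (- \<sigma> * (real l' * \<tau>)) x"
    have y: "y \<in> N" using x' by (simp add: T_def y_def)
    have "\<tau> \<le> (real l' - real l) * \<tau>" using \<open>l < l'\<close> \<tau> by (simp add: mult_le_cancel_right1)
    moreover have "?sh (\<sigma> * ((real l' - real l) * \<tau>)) y = ?sh (- \<sigma> * (real l * \<tau>)) x"
      unfolding y_def shsh by (rule restrict_ext) (simp add: left_diff_distrib right_diff_distrib)
    ultimately show False using chord[OF y] x by (fastforce simp: T_def)
  qed
  have "T l \<subseteq> {x \<in> space (leb m). dot m x x \<le> r\<^sup>2}" if "l \<le> k" for l
  proof safe
    fix x assume x: "x \<in> T l"
    then show "x \<in> space (leb m)" by (simp add: T_def)
    define y where "y = ?sh (- \<sigma> * (real l * \<tau>)) x"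
    have "dot m y y \<le> 1" using x N(2) by (simp add: T_def y_def)
    have xy: "x i = y i + (if i = j then \<sigma> * (real l * \<tau>) else 0)" if "i \<le> m" for i
      using that by (simp add: y_def)
    have "dot m x x = dot m (\<lambda>i. y i + (if i = j then \<sigma> * (real l * \<tau>) else 0))
        (\<lambda>i. y i + (if i = j then \<sigma> * (real l * \<tau>) else 0))"
      by (simp add: dot_def xy)
    then have "sqrt (dot m x x) \<le> sqrt (dot m y y) + \<bar>\<sigma> * (real l * \<tau>)\<bar>"
      using sqrt_dot_shift_le[OF j, of y] by simp
    also have "\<dots> \<le> 1 + real l * \<tau>"
      using \<open>dot m y y \<le> 1\<close> \<sigma> \<tau> by (simp add: abs_mult)
    also have "\<dots> \<le> r" using that \<tau> by (simp add: r_def)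
    finally show "dot m x x \<le> r\<^sup>2"
      by (simp add: sqrt_le_D)
  qed
  then have UT: "(\<Union>l\<in>{..k}. T l) \<subseteq> {x \<in> space (leb m). dot m x x \<le> r\<^sup>2}" by auto
  have "ennreal (real (Suc k)) * emeasure (leb m) N = (\<Sum>l\<in>{..k}. emeasure (leb m) (T l))"
    by (simp add: emT ennreal_of_nat_eq_real_of_nat)
  also have "\<dots> = emeasure (leb m) (\<Union>l\<in>{..k}. T l)"
  proof (rule sum_emeasure)
    show "disjoint_family_on T {..k}"
      unfolding disjoint_family_on_def using disj by (metis disjoint_iff linorder_neqE_nat)
  qed (use setT in auto)
  also have "\<dots> \<le> emeasure (leb m) {x \<in> space (leb m). dot m x x \<le> r\<^sup>2}"
    using UT by (rule emeasure_mono) measurable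
  also have "\<dots> \<le> ennreal (r ^ Suc m) * emeasure (leb m) (punctured_ball m)"
    by (rule emeasure_ball_le[OF r])
  also have "\<dots> \<le> ennreal 3 * emeasure (leb m) (punctured_ball m)"
    using r3 by (intro mult_right_mono ennreal_leI) auto
  finally have main: "ennreal (real (Suc k)) * emeasure (leb m) N \<le> ennreal 3 * emeasure (leb m) (punctured_ball m)" .
  have "emeasure (leb m) N \<le> ennreal (real (Suc k) * \<tau> * real (Suc m)) * emeasure (leb m) N"
    using mult_right_mono[of 1 "ennreal (real (Suc k) * \<tau> * real (Suc m))" "emeasure (leb m) N"] k2
    by simp
  also have "\<dots> = ennreal (\<tau> * real (Suc m)) * (ennreal (real (Suc k)) * emeasure (leb m) N)"
  proof -
    have "ennreal (real (Suc k) * \<tau> * real (Suc m)) = ennreal ((\<tau> * real (Suc m)) * real (Suc k))"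
      by (simp only: mult_ac)
    also have "\<dots> = ennreal (\<tau> * real (Suc m)) * ennreal (real (Suc k))"
      using \<tau> by (intro ennreal_mult) auto
    finally show ?thesis by (simp only: mult.assoc)
  qed
  also have "\<dots> \<le> ennreal (\<tau> * real (Suc m)) * (ennreal 3 * emeasure (leb m) (punctured_ball m))"
    using main by (intro mult_left_mono) auto
  also have "\<dots> = ennreal (3 * real (Suc m) * \<tau>) * emeasure (leb m) (punctured_ball m)"
  proof -
    have "ennreal (3 * real (Suc m) * \<tau>) = ennreal ((\<tau> * real (Suc m)) * 3)" by (simp only: mult_ac)
    also have "\<dots> = ennreal (\<tau> * real (Suc m)) * ennreal 3" using \<tau> by (intro ennreal_mult) auto
    finally show ?thesis by (simp only: mult.assoc)
  qed
  finally show ?thesis .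
qed

section \<open>The uniform distribution on the sphere\<close>

lemma sets_sphere_set [measurable]: "sphere_set m \<in> sets borel"
proof -
  have "sphere_set m = {x. (\<Sum>i\<le>m. (x i)\<^sup>2) = 1} \<inter> {x. \<forall>i>m. x i = 0}"
    by (auto simp: nsphere)
  moreover have "closed {x::nat\<Rightarrow>real. (\<Sum>i\<le>m. (x i)\<^sup>2) = 1}"
    by (intro closed_Collect_eq continuous_intros continuous_on_product_coordinates)
  moreover have "closed {x::nat\<Rightarrow>real. \<forall>i>m. x i = 0}"
    by (intro closed_Collect_all closed_Collect_imp closed_Collect_eq continuous_intros
          continuous_on_product_coordinates open_Collect_const)
  ultimately show ?thesis by auto
qed

lemma borel_measurable_dot [measurable]: "(\<lambda>x. dot m x p) \<in> borel_measurable borel"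
  unfolding dot_def
  by (intro borel_measurable_continuous_onI continuous_intros continuous_on_product_coordinates)

lemma sphere_setD:
  assumes "x \<in> sphere_set m"
  shows "dot m x x = 1" "i > m \<Longrightarrow> x i = 0"
  using assms by (auto simp: nsphere dot_def power2_eq_square)

lemma sphere_setI:
  assumes "dot m x x = 1" "\<And>i. i > m \<Longrightarrow> x i = 0"
  shows "x \<in> sphere_set m"
  using assms by (auto simp: nsphere dot_def power2_eq_square)

lemma radial_projection_measurable: "radial_projection m \<in> borel_measurable (leb m)"
proof (rule measurable_coordinatewise_then_product)
  fix i
  show "(\<lambda>x. radial_projection m x i) \<in> borel_measurable (leb m)"
    unfolding radial_projection_def by (cases "i \<le> m") simp_all
qed

lemma dot_radial_projection: "dot m (radial_projection m x) p = dot m x p / sqrt (dot m x x)"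
  by (simp add: dot_def radial_projection_def sum_divide_distrib)

lemma radial_projection_in_sphere:
  assumes "0 < dot m x x"
  shows "radial_projection m x \<in> sphere_set m"
proof (rule sphere_setI)
  have "dot m x (radial_projection m x) = dot m x x / sqrt (dot m x x)"
    by (subst dot_commute) (rule dot_radial_projection)
  then show "dot m (radial_projection m x) (radial_projection m x) = 1"
    using assms by (simp add: dot_radial_projection)
qed (simp add: radial_projection_def)

lemma space_uniform_sphere [simp]: "space (uniform_sphere m) = sphere_set m"
  by (simp add: uniform_sphere_def space_restrict_space)

lemma uniform_sphere_dot_measurable [measurable]:
  "(\<lambda>x. dot m x p) \<in> borel_measurable (uniform_sphere m)"
  unfolding uniform_sphere_def by (intro measurable_restrict_space1) measurable

lemma emeasure_uniform_sphere:
  assumes X: "X \<in> sets borel" "X \<subseteq> sphere_set m"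
  shows "emeasure (uniform_sphere m) X =
    emeasure (leb m) {x \<in> punctured_ball m. radial_projection m x \<in> X} / emeasure (leb m) (punctured_ball m)"
proof -
  let ?U = "uniform_measure (leb m) (punctured_ball m)"
  have rp: "radial_projection m \<in> borel_measurable ?U"
    using radial_projection_measurable by (simp cong: measurable_cong_sets)
  have B: "punctured_ball m \<in> sets (leb m)" by measurable
  have "emeasure (uniform_sphere m) X = emeasure (distr ?U borel (radial_projection m)) X"
    unfolding uniform_sphere_def using X by (intro emeasure_restrict_space) auto
  also have "\<dots> = emeasure ?U (radial_projection m -` X \<inter> space (leb m))"
    using rp X by (subst emeasure_distr) auto
  also have "\<dots> = emeasure (leb m) (punctured_ball m \<inter> (radial_projection m -` X \<inter> space (leb m)))
      / emeasure (leb m) (punctured_ball m)"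
    using B measurable_sets[OF radial_projection_measurable X(1)]
    by (rule emeasure_uniform_measure)
  also have "punctured_ball m \<inter> (radial_projection m -` X \<inter> space (leb m)) =
      {x \<in> punctured_ball m. radial_projection m x \<in> X}" by auto
  finally show ?thesis .
qed

lemma ex_large_coordinate:
  assumes "p \<in> sphere_set m"
  shows "\<exists>j\<le>m. 1 / sqrt (Suc m) \<le> \<bar>p j\<bar>"
proof (rule ccontr)
  assume "\<not> ?thesis"
  then have small: "\<bar>p j\<bar> < 1 / sqrt (Suc m)" if "j \<le> m" for j using that by force
  have "(\<Sum>j\<le>m. p j * p j) < (\<Sum>j\<le>m. 1 / real (Suc m))"
  proof (rule sum_strict_mono)
    fix j assume "j \<in> {..m}"
    then have "\<bar>p j\<bar> * \<bar>p j\<bar> < 1 / sqrt (Suc m) * (1 / sqrt (Suc m))"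
      using small[of j] by (intro mult_strict_mono) auto
    then show "p j * p j < 1 / real (Suc m)" by simp
  qed auto
  also have "\<dots> = 1" by simp
  finally show False using sphere_setD(1)[OF assms] by (simp add: dot_def)
qed

text \<open>
  The set is the layer \<open>-\<beta> \<le> h \<le> \<alpha>\<close> of the support function \<open>h(x) = max\<^sub>q \<langle>x, q\<rangle>\<close> of \<open>P\<close>, on both sides of
  the boundary of the convex cone \<open>h \<le> 0\<close>. The witness \<open>p\<close> acts as a normal vector at \<open>x\<close>: it has a
  coordinate of modulus at least \<open>1 / \<surd>(m + 1)\<close>, and moving \<open>x\<close> in that direction by
  more than \<open>(\<alpha> + \<beta>) \<surd>(m + 1)\<close> raises \<open>\<langle>x, p\<rangle>\<close> above \<open>\<alpha>\<close>, out of the set. The \<open>2 (m + 1)\<close> signed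
  coordinate directions therefore split the set into pieces without long chords.
\<close>

lemma emeasure_shell_le:
  assumes P: "finite P" "P \<subseteq> sphere_set m" and \<alpha>: "0 \<le> \<alpha>" and \<beta>: "0 \<le> \<beta>" and pos: "0 < \<alpha> + \<beta>"
  shows "emeasure (uniform_sphere m)
      {x \<in> sphere_set m. (\<forall>q\<in>P. dot m x q \<le> \<alpha>) \<and> (\<exists>p\<in>P. - \<beta> \<le> dot m x p)}
    \<le> ennreal (12 * real (Suc m) ^ 3 * (\<alpha> + \<beta>))"
proof -
  let ?X = "{x \<in> sphere_set m. (\<forall>q\<in>P. dot m x q \<le> \<alpha>) \<and> (\<exists>p\<in>P. - \<beta> \<le> dot m x p)}"
  let ?B = "emeasure (leb m) (punctured_ball m)"
  \<comment> \<open>The factor \<open>2\<close> makes the chord bound strict.\<close>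
  define \<tau> where "\<tau> = 2 * (\<alpha> + \<beta>) * sqrt (Suc m)"
  define N where "N j \<sigma> = {y \<in> space (leb m). dot m y y \<le> 1 \<and> (\<forall>q\<in>P. dot m y q \<le> \<alpha>) \<and>
      (\<exists>p\<in>P. 1 / sqrt (Suc m) \<le> \<sigma> * p j \<and> - \<beta> \<le> dot m y p)}" for j :: nat and \<sigma> :: real
  have \<tau>: "\<tau> > 0" using pos by (simp add: \<tau>_def)
  have setN: "N j \<sigma> \<in> sets (leb m)" for j \<sigma>
    unfolding N_def using P(1) by measurable
  have "?X = {x \<in> space borel. x \<in> sphere_set m \<and> (\<forall>q\<in>P. dot m x q \<le> \<alpha>) \<and> (\<exists>p\<in>P. - \<beta> \<le> dot m x p)}"
    by auto
  also have "\<dots> \<in> sets borel" using P(1) by measurable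
  finally have X: "?X \<in> sets borel" .
  have eN: "emeasure (leb m) (N j \<sigma>) \<le> ennreal (3 * real (Suc m) * \<tau>) * ?B"
    if "j \<le> m" "\<bar>\<sigma>\<bar> = 1" for j \<sigma>
  proof (rule emeasure_no_long_chord_le[OF that(1) \<tau> that(2) setN])
    fix x s assume x: "x \<in> N j \<sigma>" and s: "\<tau> \<le> s"
    show "(\<lambda>i\<in>{..m}. x i + (if i = j then \<sigma> * s else 0)) \<notin> N j \<sigma>"
    proof
      assume y: "(\<lambda>i\<in>{..m}. x i + (if i = j then \<sigma> * s else 0)) \<in> N j \<sigma>"
      from x obtain p where p: "p \<in> P" "1 / sqrt (Suc m) \<le> \<sigma> * p j" "- \<beta> \<le> dot m x p"
        by (auto simp: N_def)
      have "dot m x p + (\<sigma> * s) * p j \<le> \<alpha>"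
        using y p(1) that(1) by (simp add: N_def dot_restrict dot_shift)
      moreover have "\<tau> * (1 / sqrt (Suc m)) \<le> s * (\<sigma> * p j)"
        using s p(2) \<tau> by (intro mult_mono) auto
      moreover have "\<tau> * (1 / sqrt (Suc m)) = 2 * (\<alpha> + \<beta>)" by (simp add: \<tau>_def)
      ultimately show False using p(3) pos by (simp add: mult_ac)
    qed
  qed (simp add: N_def)
  have "{x \<in> punctured_ball m. radial_projection m x \<in> ?X} \<subseteq> (\<Union>(j, \<sigma>)\<in>{..m} \<times> {1, -1}. N j \<sigma>)"
  proof
    fix x assume "x \<in> {x \<in> punctured_ball m. radial_projection m x \<in> ?X}"
    then have x: "x \<in> space (leb m)" "0 < dot m x x" "dot m x x \<le> 1"
      and X': "\<And>q. q \<in> P \<Longrightarrow> dot m x q / sqrt (dot m x x) \<le> \<alpha>"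
        "\<exists>p\<in>P. - \<beta> \<le> dot m x p / sqrt (dot m x x)"
      by (auto simp: dot_radial_projection)
    \<comment> \<open>Scaling from the unit sphere into the ball only weakens the two inequalities, as \<open>\<alpha>, \<beta> \<ge> 0\<close>.\<close>
    have r: "0 < sqrt (dot m x x)" "sqrt (dot m x x) \<le> 1" using x by auto
    have up: "dot m x q \<le> \<alpha>" if "q \<in> P" for q
    proof -
      have "dot m x q \<le> \<alpha> * sqrt (dot m x x)" using X'(1)[OF that] r by (simp add: pos_divide_le_eq)
      also have "\<dots> \<le> \<alpha> * 1" using r \<alpha> by (intro mult_left_mono)
      finally show ?thesis by simp
    qed
    obtain p where p: "p \<in> P" "- \<beta> \<le> dot m x p / sqrt (dot m x x)" using X'(2) by auto
    have "- \<beta> \<le> - \<beta> * sqrt (dot m x x)"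
      using mult_left_mono[OF r(2) \<beta>] by simp
    also have "\<dots> \<le> dot m x p" using p(2) r by (simp add: pos_le_divide_eq)
    finally have lo: "- \<beta> \<le> dot m x p" .
    obtain j where j: "j \<le> m" "1 / sqrt (Suc m) \<le> \<bar>p j\<bar>"
      using ex_large_coordinate p(1) P(2) by blast
    then have "x \<in> N j 1 \<or> x \<in> N j (-1)"
      using x up p(1) lo unfolding N_def by (auto simp: abs_real_def split: if_splits)
    then show "x \<in> (\<Union>(j, \<sigma>)\<in>{..m} \<times> {1, -1}. N j \<sigma>)" using j(1) by auto
  qed
  then have "emeasure (leb m) {x \<in> punctured_ball m. radial_projection m x \<in> ?X}
      \<le> emeasure (leb m) (\<Union>(j, \<sigma>)\<in>{..m} \<times> {1, -1}. N j \<sigma>)"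
    using setN by (intro emeasure_mono) auto
  also have "\<dots> \<le> (\<Sum>z\<in>{..m} \<times> {1, -1}. emeasure (leb m) (case z of (j, \<sigma>) \<Rightarrow> N j \<sigma>))"
    using setN by (intro emeasure_subadditive_finite) auto
  also have "\<dots> \<le> (\<Sum>z\<in>{..m} \<times> {1, -1::real}. ennreal (3 * real (Suc m) * \<tau>) * ?B)"
    using eN by (intro sum_mono) auto
  also have "\<dots> = ennreal (2 * real (Suc m)) * (ennreal (3 * real (Suc m) * \<tau>) * ?B)"
    by (simp add: card_cartesian_product ennreal_of_nat_eq_real_of_nat mult_ac)
  also have "\<dots> = ennreal (2 * real (Suc m) * (3 * real (Suc m) * \<tau>)) * ?B"
    using \<tau> by (subst ennreal_mult) (auto simp: mult.assoc)
  also have "\<dots> \<le> ennreal (12 * real (Suc m) ^ 3 * (\<alpha> + \<beta>)) * ?B"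
  proof (intro mult_right_mono ennreal_leI)
    have "sqrt (Suc m) \<le> real (Suc m)" by (intro real_le_lsqrt) (auto simp: power2_eq_square)
    then have "(12 * real (Suc m) ^ 2 * (\<alpha> + \<beta>)) * sqrt (Suc m) \<le> (12 * real (Suc m) ^ 2 * (\<alpha> + \<beta>)) * real (Suc m)"
      using pos by (intro mult_left_mono) auto
    moreover have "2 * real (Suc m) * (3 * real (Suc m) * \<tau>) = (12 * real (Suc m) ^ 2 * (\<alpha> + \<beta>)) * sqrt (Suc m)"
      unfolding \<tau>_def power2_eq_square by (simp only: mult_ac)
    moreover have "(12 * real (Suc m) ^ 2 * (\<alpha> + \<beta>)) * real (Suc m) = 12 * real (Suc m) ^ 3 * (\<alpha> + \<beta>)"
      by (simp only: power3_eq_cube power2_eq_square mult_ac)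
    ultimately show "2 * real (Suc m) * (3 * real (Suc m) * \<tau>) \<le> 12 * real (Suc m) ^ 3 * (\<alpha> + \<beta>)"
      by linarith
  qed auto
  finally have main: "emeasure (leb m) {x \<in> punctured_ball m. radial_projection m x \<in> ?X}
    \<le> ennreal (12 * real (Suc m) ^ 3 * (\<alpha> + \<beta>)) * ?B" .
  have "emeasure (uniform_sphere m) ?X \<le> (ennreal (12 * real (Suc m) ^ 3 * (\<alpha> + \<beta>)) * ?B) / ?B"
    using emeasure_uniform_sphere[OF X] main by (auto intro: divide_right_mono_ennreal)
  also have "\<dots> \<le> ennreal (12 * real (Suc m) ^ 3 * (\<alpha> + \<beta>)) * 1"
  proof -
    have "?B / ?B \<le> 1"
      by (cases "?B = 0 \<or> ?B = top") (auto simp: divide_ennreal_def[of top] ennreal_divide_self less_top)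
    then show ?thesis unfolding ennreal_times_divide[symmetric] by (intro mult_left_mono) auto
  qed
  finally show ?thesis by simp
qed

lemma uniform_sphere_symmetric:
  assumes p: "p \<in> sphere_set m"
  shows "emeasure (uniform_sphere m) {x \<in> sphere_set m. \<beta> < dot m x p} =
    emeasure (uniform_sphere m) {x \<in> sphere_set m. dot m x p < - \<beta>}"
proof -
  let ?X = "{x \<in> sphere_set m. \<beta> < dot m x p}" and ?Y = "{x \<in> sphere_set m. dot m x p < - \<beta>}"
  let ?V = "{x \<in> punctured_ball m. radial_projection m x \<in> ?X}"
  have "?X = {x \<in> space borel. x \<in> sphere_set m \<and> \<beta> < dot m x p}" by auto
  also have "\<dots> \<in> sets borel" by measurable
  finally have X: "?X \<in> sets borel" .
  have "?Y = {x \<in> space borel. x \<in> sphere_set m \<and> dot m x p < - \<beta>}" by auto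
  also have "\<dots> \<in> sets borel" by measurable
  finally have Y: "?Y \<in> sets borel" .
  have "?V = punctured_ball m \<inter> (radial_projection m -` ?X \<inter> space (leb m))" by auto
  also have "\<dots> \<in> sets (leb m)"
    using measurable_sets[OF radial_projection_measurable X] by (rule sets.Int[rotated]) measurable
  finally have V: "?V \<in> sets (leb m)" .
  have neg: "dot m (\<lambda>i\<in>{..m}. 0 + (-1) * x i) q = - dot m x q"
    "dot m (\<lambda>i\<in>{..m}. 0 + (-1) * x i) (\<lambda>i\<in>{..m}. 0 + (-1) * x i) = dot m x x" for x q
    by (auto simp: dot_def sum_negf)
  have "emeasure (leb m) ?V =
      emeasure (leb m) {x \<in> space (leb m). (\<lambda>i\<in>{..m}. 0 + (-1) * x i) \<in> ?V}"
    using emeasure_PiM_lborel_affine[OF _ _ V, of "-1" "\<lambda>_. 0"] by simp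
  also have "{x \<in> space (leb m). (\<lambda>i\<in>{..m}. 0 + (-1) * x i) \<in> ?V} =
      {x \<in> punctured_ball m. radial_projection m x \<in> ?Y}"
  proof -
    have pointwise: "y \<in> ?V \<longleftrightarrow> x \<in> punctured_ball m \<and> radial_projection m x \<in> ?Y"
      if "x \<in> space (leb m)" "y \<in> space (leb m)" "dot m y y = dot m x x" "dot m y p = - dot m x p" for x y
      using that by (auto simp: dot_radial_projection radial_projection_in_sphere)
    have "(\<lambda>i\<in>{..m}. 0 + (-1) * x i) \<in> ?V \<longleftrightarrow>
        x \<in> punctured_ball m \<and> radial_projection m x \<in> ?Y" if "x \<in> space (leb m)" for x
      by (rule pointwise[OF that _ neg(2) neg(1)]) (simp add: space_PiM)
    then show ?thesis by blast
  qed
  finally show ?thesis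
    by (simp add: emeasure_uniform_sphere X Y)
qed

text \<open>
  A half-sphere has measure at most \<open>1/2\<close>, and the constant is chosen such that the equatorial band of
  half-width \<open>1 / (96 (m + 1)\<^sup>3)\<close> has measure at most \<open>1/4\<close>.
\<close>

lemma emeasure_cap_le:
  assumes p: "p \<in> sphere_set m"
  shows "emeasure (uniform_sphere m) {x \<in> sphere_set m. - (1 / (96 * real (Suc m) ^ 3)) \<le> dot m x p} \<le> ennreal (3 / 4)"
proof -
  interpret prob_space "uniform_sphere m" by (rule prob_space_uniform_sphere)
  define \<beta> where "\<beta> = 1 / (96 * real (Suc m) ^ 3)"
  have \<beta>: "\<beta> > 0" by (simp add: \<beta>_def)
  let ?X = "{x \<in> space (uniform_sphere m). \<beta> < dot m x p}" and ?Y = "{x \<in> space (uniform_sphere m). dot m x p < - \<beta>}"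
  let ?Z = "{x \<in> space (uniform_sphere m). dot m x p \<le> \<beta> \<and> - \<beta> \<le> dot m x p}"
  have sym: "prob ?X = prob ?Y"
    using uniform_sphere_symmetric[OF p] by (simp add: measure_def)
  have "emeasure (uniform_sphere m) ?Z \<le> ennreal (12 * real (Suc m) ^ 3 * (\<beta> + \<beta>))"
    using emeasure_shell_le[of "{p}" m \<beta> \<beta>] p \<beta> by simp
  also have "12 * real (Suc m) ^ 3 * (\<beta> + \<beta>) = 1 / 4"
    by (simp add: \<beta>_def field_simps del: of_nat_Suc)
  finally have Z: "prob ?Z \<le> 1 / 4" by (simp add: emeasure_eq_measure)
  have [measurable]: "?X \<in> events" "?Y \<in> events" "?Z \<in> events" by measurable
  have "prob (?X \<union> ?Y) = prob ?X + prob ?Y"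
    using \<beta> by (intro finite_measure_Union) (measurable, auto)
  then have X: "prob ?X \<le> 1 / 2" using sym prob_le_1[of "?X \<union> ?Y"] by simp
  have "{x \<in> sphere_set m. - \<beta> \<le> dot m x p} = ?X \<union> ?Z" using \<beta> by auto
  moreover have "prob (?X \<union> ?Z) = prob ?X + prob ?Z"
    by (intro finite_measure_Union) (measurable, auto)
  ultimately show ?thesis using X Z unfolding \<beta>_def[symmetric]
    by (simp add: emeasure_eq_measure del: ennreal_plus)
qed

lemma sphere_coordinate_le:
  assumes "x \<in> sphere_set m"
  shows "\<bar>x j\<bar> \<le> 1"
proof (cases "j \<le> m")
  case True
  then have "x j * x j \<le> dot m x x"
    unfolding dot_def by (intro member_le_sum) auto
  then show ?thesis
    using sphere_setD(1)[OF assms] abs_square_le_1[of "x j"] by (simp add: power2_eq_square)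
qed (use sphere_setD(2)[OF assms] in simp)

section \<open>Finite nets of the sphere\<close>

definition sphere_net :: "nat \<Rightarrow> real \<Rightarrow> (nat \<Rightarrow> real) set \<Rightarrow> bool" where
  "sphere_net m \<delta> G \<longleftrightarrow> finite G \<and> G \<subseteq> sphere_set m \<and>
    (\<forall>p\<in>sphere_set m. \<exists>g\<in>G. \<forall>x\<in>sphere_set m. \<bar>dot m x p - dot m x g\<bar> \<le> \<delta>)"

text \<open>
  One representative is chosen from each grid cell of side \<open>1/N\<close> that meets the sphere, so that the
  net consists of unit vectors.
\<close>

lemma ex_sphere_net_card_le:
  assumes "N > 0"
  shows "\<exists>G. sphere_net m (real (Suc m) / real N) G \<and> card G \<le> (2 * N + 1) ^ Suc m"
proof -
  define cell where "cell p = (\<lambda>j\<in>{..m}. \<lfloor>p j * real N\<rfloor>)" for p :: "nat \<Rightarrow> real"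
  define rep where "rep c = (SOME p. p \<in> sphere_set m \<and> cell p = c)" for c
  have rep: "rep c \<in> sphere_set m \<and> cell (rep c) = c" if "c \<in> cell ` sphere_set m" for c
    unfolding rep_def using that by (intro someI_ex[of "\<lambda>p. p \<in> sphere_set m \<and> cell p = c"]) auto
  have cells: "cell ` sphere_set m \<subseteq> (\<Pi>\<^sub>E j\<in>{..m}. {- int N..int N})"
  proof
    fix c assume "c \<in> cell ` sphere_set m"
    then obtain p where p: "p \<in> sphere_set m" "c = cell p" by auto
    have "\<lfloor>p j * real N\<rfloor> \<in> {- int N..int N}" for j
    proof -
      have "\<bar>p j * real N\<bar> \<le> 1 * real N"
        unfolding abs_mult using sphere_coordinate_le[OF p(1), of j] by (intro mult_mono) auto
      then have "- real N \<le> p j * real N" "p j * real N \<le> real N" by (auto simp: abs_le_iff)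
      then show ?thesis by (auto simp: le_floor_iff floor_le_iff)
    qed
    then show "c \<in> (\<Pi>\<^sub>E j\<in>{..m}. {- int N..int N})" by (auto simp: p(2) cell_def)
  qed
  have box: "finite (\<Pi>\<^sub>E j\<in>{..m}. {- int N..int N})" "card (\<Pi>\<^sub>E j\<in>{..m}. {- int N..int N}) = (2 * N + 1) ^ Suc m"
  proof -
    have "nat (int N + 1 + int N) = 2 * N + 1" by simp
    then show "card (\<Pi>\<^sub>E j\<in>{..m}. {- int N..int N}) = (2 * N + 1) ^ Suc m"
      by (subst card_PiE) simp_all
  qed (auto intro: finite_PiE)
  let ?G = "rep ` cell ` sphere_set m"
  have fin: "finite (cell ` sphere_set m)" using cells box(1) by (rule finite_subset)
  have "card ?G \<le> card (cell ` sphere_set m)" using fin by (rule card_image_le)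
  also have "\<dots> \<le> (2 * N + 1) ^ Suc m" using card_mono[OF box(1) cells] box(2) by simp
  finally have card: "card ?G \<le> (2 * N + 1) ^ Suc m" .
  have "\<bar>dot m x p - dot m x (rep (cell p))\<bar> \<le> real (Suc m) / real N"
    if p: "p \<in> sphere_set m" and x: "x \<in> sphere_set m" for p x
  proof -
    define g where "g = rep (cell p)"
    have g: "cell g = cell p" using rep p by (auto simp: g_def)
    have step: "\<bar>p j - g j\<bar> \<le> 1 / real N" if "j \<le> m" for j
    proof -
      have "\<lfloor>g j * real N\<rfloor> = \<lfloor>p j * real N\<rfloor>"
        using fun_cong[OF g, of j] that by (simp add: cell_def)
      then have "\<bar>p j * real N - g j * real N\<bar> \<le> 1" by linarith
      then have "\<bar>p j - g j\<bar> * real N \<le> 1"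
        by (simp add: abs_mult flip: left_diff_distrib)
      then show ?thesis using assms by (simp add: field_simps)
    qed
    have "\<bar>dot m x p - dot m x g\<bar> = \<bar>\<Sum>j\<le>m. x j * (p j - g j)\<bar>"
      by (simp add: dot_def right_diff_distrib sum_subtractf)
    also have "\<dots> \<le> (\<Sum>j\<le>m. \<bar>x j * (p j - g j)\<bar>)" by (rule sum_abs)
    also have "\<dots> \<le> (\<Sum>j\<le>m. 1 * (1 / real N))"
      unfolding abs_mult using sphere_coordinate_le[OF x] step by (intro sum_mono mult_mono) auto
    also have "\<dots> = real (Suc m) / real N" by simp
    finally show ?thesis by (simp add: g_def)
  qed
  then have "sphere_net m (real (Suc m) / real N) ?G"
    unfolding sphere_net_def using fin rep by (auto intro!: bexI)
  with card show ?thesis by blast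
qed

lemma ex_sphere_net:
  assumes "\<delta> > 0"
  shows "\<exists>G. sphere_net m \<delta> G"
proof -
  define N where "N = nat \<lceil>real (Suc m) / \<delta>\<rceil>"
  have "0 < real (Suc m) / \<delta>" using assms by simp
  then have N: "N > 0" "real (Suc m) / \<delta> \<le> real N" by (auto simp: N_def real_nat_ceiling_ge)
  then have "real (Suc m) / real N \<le> \<delta>" using assms by (simp add: field_simps)
  moreover obtain G where "sphere_net m (real (Suc m) / real N) G"
    using ex_sphere_net_card_le[OF N(1)] by blast
  ultimately show ?thesis unfolding sphere_net_def by (meson order_trans)
qed

section \<open>Distance to ill-posedness\<close>

text \<open>
  The left-hand side is at most the chord \<open>\<parallel>a - b\<parallel> = 2 sin (\<theta> / 2)\<close>, which is at most the angle \<open>\<theta>\<close>.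
\<close>

lemma dot_diff_le_angular_dist:
  assumes "a \<in> sphere_set m" "b \<in> sphere_set m" "q \<in> sphere_set m"
  shows "\<bar>dot m a q - dot m b q\<bar> \<le> angular_dist m a b"
proof -
  define \<theta> where "\<theta> = angular_dist m a b"
  have ab: "\<bar>dot m a b\<bar> \<le> 1" using assms by (intro dot_in_cball)
  then have \<theta>: "0 \<le> \<theta>" "cos \<theta> = dot m a b"
    by (auto simp: \<theta>_def angular_dist_def arccos_lbound abs_le_iff)
  have "(dot m a q - dot m b q)\<^sup>2 = (\<Sum>j\<le>m. (a j - b j) * q j)\<^sup>2"
    by (simp add: dot_def left_diff_distrib sum_subtractf)
  also have "\<dots> \<le> (\<Sum>j\<le>m. (a j - b j)\<^sup>2) * (\<Sum>j\<le>m. (q j)\<^sup>2)"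
    by (rule Cauchy_Schwarz_ineq_sum)
  also have "\<dots> = (\<Sum>j\<le>m. a j * a j + b j * b j - 2 * (a j * b j)) * dot m q q"
    by (simp add: dot_def power2_eq_square algebra_simps)
  also have "\<dots> = 2 - 2 * cos \<theta>"
    using sphere_setD(1)[OF assms(1)] sphere_setD(1)[OF assms(2)] sphere_setD(1)[OF assms(3)] \<theta>(2)
    by (simp add: dot_def sum.distrib sum_subtractf flip: sum_distrib_left)
  also have "\<dots> = 4 * (sin (\<theta> / 2))\<^sup>2"
    using cos_double_sin[of "\<theta> / 2"] by simp
  also have "\<dots> \<le> 4 * (\<theta> / 2)\<^sup>2"
    using abs_sin_x_le_abs_x[of "\<theta> / 2"] unfolding abs_le_square_iff by simp
  also have "\<dots> = \<theta>\<^sup>2" by (simp add: power_divide)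
  finally show ?thesis using \<theta>(1) by (auto simp: \<theta>_def[symmetric] abs_le_square_iff[symmetric])
qed

lemma uminus_in_sphere: "x \<in> sphere_set m \<Longrightarrow> (\<lambda>j. - x j) \<in> sphere_set m"
  by (auto simp: nsphere)

lemma dot_uminus: "dot m x (\<lambda>j. - y j) = - dot m x y" "dot m (\<lambda>j. - x j) y = - dot m x y"
  by (simp_all add: dot_def sum_negf)

lemma continuous_map_nsphere_dot: "continuous_map (nsphere m) euclideanreal (\<lambda>x. dot m a x)"
proof -
  have "continuous_map (powertop_real UNIV) euclideanreal (\<lambda>x. dot m a x)"
    unfolding dot_def
    by (intro continuous_map_sum continuous_map_real_mult continuous_map_product_projection) auto
  then show ?thesis unfolding nsphere by (rule continuous_map_from_subtopology)
qed

lemma strictly_feasibleI: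
  assumes "q \<in> sphere_set m" "\<And>i. i < n \<Longrightarrow> dot m (B i) q < 0"
  shows "strictly_feasible n m B"
proof -
  let ?U = "\<Inter>i\<in>{..<n}. {x \<in> sphere_set m. dot m (B i) x \<in> {..<0}}"
  have "openin (nsphere m) (sphere_set m \<inter> ?U)"
  proof (cases "n = 0")
    case False
    have "openin (nsphere m) {x \<in> sphere_set m. dot m (B i) x \<in> {..<0}}" for i
      by (rule openin_continuous_map_preimage[OF continuous_map_nsphere_dot]) simp
    then show ?thesis using False by (intro openin_Int openin_topspace openin_INT) auto
  qed auto
  moreover have "q \<in> sphere_set m \<inter> ?U" using assms by auto
  moreover have "sphere_set m \<inter> ?U \<subseteq> solution_set n m B" by (auto simp: solution_set_def less_imp_le)
  ultimately show ?thesis unfolding strictly_feasible_def interior_of_def by blast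
qed

text \<open>
  Up to constants this is the event \<open>-\<delta> \<le> t(A) \<le> \<delta>\<close>, with the maximum over the sphere in \<open>t\<close> restricted to
  the net \<open>G\<close>. The bound \<open>2\<delta>\<close> absorbs the error of rounding an optimal direction to \<open>G\<close>.
\<close>

definition near_ill_posed :: "nat \<Rightarrow> nat \<Rightarrow> (nat \<Rightarrow> real) set \<Rightarrow> real \<Rightarrow> (nat \<Rightarrow> nat \<Rightarrow> real) set" where
  "near_ill_posed n m G \<delta> = {A \<in> instances n m.
     (\<exists>g\<in>G. \<forall>i<n. - (2 * \<delta>) \<le> dot m (A i) g) \<and> (\<forall>g\<in>G. \<exists>i<n. dot m (A i) g \<le> \<delta>)}"

text \<open>
  A solution \<open>x\<close> of \<open>B\<close> yields the direction \<open>-x\<close>, which all rows of \<open>A\<close> see at height at least \<open>-\<delta>\<close>. A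
  direction seen above \<open>\<delta>\<close> by all rows of \<open>A\<close> would be seen strictly above \<open>0\<close> by all rows
  of \<open>B\<close>, which would make \<open>B\<close> strictly feasible.
\<close>

lemma near_ill_posedI:
  assumes A: "A \<in> instances n m" and B: "B \<in> ill_posed n m" and d: "instance_dist n m A B \<le> \<delta>"
    and G: "sphere_net m \<delta> G"
  shows "A \<in> near_ill_posed n m G \<delta>"
proof -
  have Ai: "A i \<in> sphere_set m" and Bi: "B i \<in> sphere_set m" if "i < n" for i
    using A B that by (auto simp: instances_def ill_posed_def)
  have close: "\<bar>dot m (A i) q - dot m (B i) q\<bar> \<le> \<delta>" if "i < n" "q \<in> sphere_set m" for i q
  proof -
    have "angular_dist m (A i) (B i) \<le> instance_dist n m A B"
      unfolding instance_dist_def using that(1) by (intro Max_ge) auto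
    with dot_diff_le_angular_dist[OF Ai[OF that(1)] Bi[OF that(1)] that(2)] d show ?thesis by linarith
  qed
  obtain x where x: "x \<in> sphere_set m" "\<And>i. i < n \<Longrightarrow> dot m (B i) x \<le> 0"
    using B by (auto simp: ill_posed_def feasible_def solution_set_def)
  define p where "p = (\<lambda>j. - x j)"
  have p: "p \<in> sphere_set m" using x(1) by (simp add: p_def uminus_in_sphere)
  have pB: "0 \<le> dot m (B i) p" if "i < n" for i using x(2)[OF that] by (simp add: p_def dot_uminus)
  obtain g where g: "g \<in> G" "\<And>x. x \<in> sphere_set m \<Longrightarrow> \<bar>dot m x p - dot m x g\<bar> \<le> \<delta>"
    using G p unfolding sphere_net_def by blast
  have "- (2 * \<delta>) \<le> dot m (A i) g" if "i < n" for i
    using close[OF that p] pB[OF that] g(2)[OF Ai[OF that]] by linarith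
  moreover have "\<exists>i<n. dot m (A i) g \<le> \<delta>" if g: "g \<in> G" for g
  proof (rule ccontr)
    assume "\<not> ?thesis"
    then have far: "\<delta> < dot m (A i) g" if "i < n" for i using that by force
    have gS: "g \<in> sphere_set m" using g G by (auto simp: sphere_net_def)
    have "dot m (B i) (\<lambda>j. - g j) < 0" if "i < n" for i
      using close[OF that gS] far[OF that] by (simp add: dot_uminus)
    then have "strictly_feasible n m B"
      using uminus_in_sphere[OF gS] by (intro strictly_feasibleI)
    then show False using B by (simp add: ill_posed_def)
  qed
  ultimately show ?thesis using A g(1) by (auto simp: near_ill_posed_def)
qed

lemma ex_orthogonal:
  assumes "m \<ge> 1"
  shows "\<exists>x\<in>sphere_set m. dot m v x = 0"
proof -
  have split: "{..m} = insert 0 (insert 1 {2..m})" using assms by auto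
  define w :: "nat \<Rightarrow> real" where "w = (\<lambda>j. if v 0 = 0 \<and> v 1 = 0 then (if j = 0 then 1 else 0)
      else (if j = 0 then - v 1 else if j = 1 then v 0 else 0))"
  have "dot m w v = 0" "0 < dot m w w"
    using sum_power2_gt_zero_iff[of "v 0" "v 1"] unfolding dot_def split
    by (auto simp: w_def power2_eq_square add.commute)
  then show ?thesis
    using radial_projection_in_sphere[of m w]
    by (intro bexI[of _ "radial_projection m w"])
       (simp_all add: dot_radial_projection dot_commute[of m v])
qed

text \<open>
  The solution set is the great subsphere orthogonal to \<open>v\<close>: nonempty, but any of its points leaves it
  when rotated towards \<open>v\<close>.
\<close>

lemma opposite_rows_ill_posed:
  assumes m: "m \<ge> 1" and v: "v \<in> sphere_set m" and B: "B \<in> instances n m"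
    and rows: "\<And>i. i < n \<Longrightarrow> B i = v \<or> B i = (\<lambda>j. - v j)"
    and ij: "i < n" "j < n" "B i = v" "B j = (\<lambda>j. - v j)"
  shows "B \<in> ill_posed n m"
proof -
  have sol: "dot m v x = 0" if "x \<in> solution_set n m B" for x
  proof -
    have "dot m (B i) x \<le> 0" "dot m (B j) x \<le> 0"
      using that ij(1,2) by (auto simp: solution_set_def)
    then show ?thesis using ij(3,4) by (simp add: dot_uminus)
  qed
  obtain x where x: "x \<in> sphere_set m" "dot m v x = 0" using ex_orthogonal[OF m] by blast
  then have "x \<in> solution_set n m B"
    using rows by (fastforce simp: solution_set_def dot_uminus)
  then have feas: "feasible n m B" by (auto simp: feasible_def)
  have "nsphere m interior_of solution_set n m B = {}"
  proof (rule ccontr)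
    assume "\<not> ?thesis"
    then obtain U x where U: "openin (nsphere m) U" "x \<in> U" "U \<subseteq> solution_set n m B"
      by (auto simp: interior_of_def)
    then have x: "x \<in> sphere_set m" "dot m v x = 0" using sol by (auto simp: solution_set_def)
    define g where "g t = (\<lambda>j. cos t * x j + sin t * v j)" for t :: real
    have dg: "dot m y (g t) = cos t * dot m y x + sin t * dot m y v" for y t
      by (simp add: dot_def g_def distrib_left sum.distrib sum_distrib_left mult_ac)
    have gS: "g t \<in> sphere_set m" for t
    proof (rule sphere_setI)
      have "dot m (g t) x = cos t" "dot m (g t) v = sin t"
        using x v dg[of x t] dg[of v t] sphere_setD(1)[OF v] sphere_setD(1)[OF x(1)]
        by (auto simp: dot_commute[of m "g t"] dot_commute[of m x v])
      then show "dot m (g t) (g t) = 1"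
        unfolding dg by (simp flip: power2_eq_square)
    qed (simp add: g_def sphere_setD(2)[OF x(1)] sphere_setD(2)[OF v])
    have "continuous_map euclidean (nsphere m) g"
    proof -
      have "continuous_map euclidean (powertop_real UNIV) g"
        by (auto simp: continuous_map_componentwise_UNIV g_def intro!: continuous_intros)
      then show ?thesis using gS by (auto simp: nsphere continuous_map_in_subtopology)
    qed
    from openin_continuous_map_preimage[OF this U(1)]
    have "open {t. g t \<in> U}" by simp
    moreover have "g 0 = x" by (auto simp: g_def)
    ultimately obtain d where d: "d > 0" "\<And>t. \<bar>t\<bar> < d \<Longrightarrow> g t \<in> U"
      using U(2) unfolding open_dist by (force simp: dist_real_def)
    define t where "t = min (d / 2) 1"
    have t: "0 < t" "t < d" "t < pi" using d(1) pi_gt3 by (auto simp: t_def min_def)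
    then have "dot m v (g t) = 0" using d(2)[of t] U(3) sol by auto
    then have "sin t = 0" using x(2) sphere_setD(1)[OF v] by (simp add: dg)
    then show False using sin_gt_zero[of t] t by auto
  qed
  then show ?thesis using B feas by (auto simp: ill_posed_def strictly_feasible_def)
qed

text \<open>
  This keeps the distance in the range where the sine is increasing, so that a lower bound on the distance
  is one on its sine. Each row is replaced by the closer one of two antipodal points \<open>v\<close> and \<open>-v\<close>; the
  choice of \<open>v\<close> proportional to \<open>a\<^sub>0 - a\<^sub>1\<close> (or orthogonal to \<open>a\<^sub>0 = a\<^sub>1\<close>) allows both of them to occur.
\<close>

lemma ex_ill_posed_within_half_pi:
  assumes m: "m \<ge> 1" and n: "n \<ge> 2" and A: "A \<in> instances n m"
  shows "\<exists>B\<in>ill_posed n m. instance_dist n m A B \<le> pi / 2"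
proof -
  have Ai: "A i \<in> sphere_set m" if "i < n" for i using A that by (auto simp: instances_def)
  have A0: "A 0 \<in> sphere_set m" and A1: "A 1 \<in> sphere_set m" using Ai n by auto
  have "\<exists>v\<in>sphere_set m. 0 \<le> dot m (A 0) v \<and> dot m (A 1) v \<le> 0"
  proof -
    define d where "d = (\<lambda>j. A 0 j - A 1 j)"
    have dd: "dot m y d = dot m y (A 0) - dot m y (A 1)" for y
      by (simp add: dot_def d_def right_diff_distrib sum_subtractf)
    show ?thesis
    proof (cases "0 < dot m d d")
      case True
      have le: "dot m (A 0) (A 1) \<le> 1" using dot_in_cball[OF A0 A1] by simp
      have e: "dot m d (A 0) = 1 - dot m (A 0) (A 1)" "dot m d (A 1) = dot m (A 0) (A 1) - 1"
        using sphere_setD(1)[OF A0] sphere_setD(1)[OF A1] dd[of "A 0"] dd[of "A 1"]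
          dot_commute[of m d] dot_commute[of m "A 1" "A 0"] by auto
      have v: "dot m y (radial_projection m d) = dot m d y / sqrt (dot m d d)" for y
        by (subst dot_commute) (rule dot_radial_projection)
      have "0 \<le> dot m (A 0) (radial_projection m d)" "dot m (A 1) (radial_projection m d) \<le> 0"
        unfolding v e using True le by (auto intro: divide_nonpos_pos)
      then show ?thesis using radial_projection_in_sphere[OF True] by blast
    next
      case False
      then have "dot m v d = 0" for v using dot_self_pos by blast
      then have "dot m (A 0) v = dot m (A 1) v" for v
        using dd[of v] by (simp add: dot_commute[of m "A _"])
      moreover obtain v where "v \<in> sphere_set m" "dot m (A 0) v = 0"
        using ex_orthogonal[OF m, of "A 0"] by blast
      ultimately show ?thesis by (metis order_refl)
    qed
  qed
  then obtain v where v: "v \<in> sphere_set m" "0 \<le> dot m (A 0) v" "dot m (A 1) v \<le> 0" by blast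
  define B where "B = (\<lambda>i\<in>{..<n}. if 0 \<le> dot m (A i) v \<and> i \<noteq> 1 then v else (\<lambda>j. - v j))"
  have "B \<in> instances n m" using v(1) uminus_in_sphere[OF v(1)] by (auto simp: instances_def B_def)
  then have "B \<in> ill_posed n m"
    using n v(2) by (intro opposite_rows_ill_posed[OF m v(1), of B n 0 1]) (auto simp: B_def)
  moreover have "angular_dist m (A i) (B i) \<le> pi / 2" if "i < n" for i
  proof -
    have "0 \<le> dot m (A i) (B i)"
      using that v(3) by (auto simp: B_def dot_uminus)
    moreover have "\<bar>dot m (A i) (B i)\<bar> \<le> 1"
      using that Ai \<open>B \<in> instances n m\<close> by (intro dot_in_cball) (auto simp: instances_def)
    ultimately show ?thesis
      unfolding angular_dist_def by (intro arccos_le_pi2) (auto simp: abs_le_iff)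
  qed
  moreover from this have "instance_dist n m A B \<le> pi / 2"
    unfolding instance_dist_def using n by (subst Max_le_iff) (auto simp: lessThan_empty_iff)
  ultimately show ?thesis by blast
qed

lemma half_le_sin:
  fixes x :: real assumes "0 \<le> x" "x \<le> 1" shows "x / 2 \<le> sin x"
proof -
  have "(\<lambda>y. sin y - y / 2) 0 \<le> (\<lambda>y. sin y - y / 2) x"
  proof (rule DERIV_nonneg_imp_nondecreasing[OF assms(1)])
    fix y :: real assume y: "0 \<le> y" "y \<le> x"
    have "cos (pi / 3) \<le> cos y" using y assms pi_gt3 by (intro cos_monotone_0_pi_le) auto
    then have "0 \<le> cos y - 1 / 2" by (simp add: cos_60)
    moreover have "((\<lambda>y. sin y - y / 2) has_real_derivative cos y - 1 / 2) (at y)"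
      by (auto intro!: derivative_eq_intros)
    ultimately show "\<exists>z. ((\<lambda>y. sin y - y / 2) has_real_derivative z) (at y) \<and> 0 \<le> z" by blast
  qed
  then show ?thesis by simp
qed

lemma gcc_condition_le:
  assumes m: "m \<ge> 1" and n: "n \<ge> 2" and A: "A \<in> instances n m"
    and \<delta>: "0 < \<delta>" "\<delta> \<le> 1" and G: "sphere_net m \<delta> G" and far: "A \<notin> near_ill_posed n m G \<delta>"
  shows "gcc_condition n m A \<le> ereal (2 / \<delta>)"
proof -
  obtain B0 where B0: "B0 \<in> ill_posed n m" "instance_dist n m A B0 \<le> pi / 2"
    using ex_ill_posed_within_half_pi[OF m n A] by blast
  have away: "\<delta> < instance_dist n m A B" if "B \<in> ill_posed n m" for B
    using near_ill_posedI[OF A that _ G] far by force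
  have "\<delta> \<le> dist_ill_posed n m A"
    unfolding dist_ill_posed_def using B0 away by (intro cINF_greatest) (auto intro: less_imp_le)
  moreover have "dist_ill_posed n m A \<le> pi / 2"
    unfolding dist_ill_posed_def
  proof (rule cINF_lower2[where f="instance_dist n m A", OF _ B0])
    show "bdd_below (instance_dist n m A ` ill_posed n m)"
      using away by (intro bdd_belowI[of _ \<delta>]) (auto intro: less_imp_le)
  qed
  ultimately have "sin \<delta> \<le> sin (dist_ill_posed n m A)"
    using \<delta> pi_gt3 by (intro sin_monotone_2pi_le) auto
  then have s: "\<delta> / 2 \<le> sin (dist_ill_posed n m A)" using half_le_sin[of \<delta>] \<delta> by linarith
  have "A \<notin> ill_posed n m"
  proof
    assume "A \<in> ill_posed n m"
    have self: "angular_dist m (A i) (A i) = 0" if "i < n" for i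
    proof -
      have "A i \<in> sphere_set m" using A that by (auto simp: instances_def)
      then show ?thesis by (simp add: angular_dist_def sphere_setD(1))
    qed
    have "{..<n} \<noteq> {}" using n by (simp add: lessThan_empty_iff)
    then have "instance_dist n m A A \<le> 0"
      unfolding instance_dist_def using self by (subst Max_le_iff) simp_all
    then show False using away[OF \<open>A \<in> ill_posed n m\<close>] \<delta>(1) by linarith
  qed
  moreover have "1 / sin (dist_ill_posed n m A) \<le> 1 / (\<delta> / 2)"
    using s \<delta> by (intro divide_left_mono) auto
  ultimately show ?thesis using s \<delta> by (simp add: gcc_condition_def one_ereal_def)
qed

section \<open>Probability of being nearly ill-posed\<close>

lemma emeasure_PiM_fiber_le:
  fixes M :: "'i \<Rightarrow> 'a measure"
  assumes M: "\<And>i. prob_space (M i)" and I: "finite I" "i \<in> I" and E: "E \<in> sets (PiM I M)"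
    and fiber: "\<And>x. x \<in> space (PiM (I - {i}) M) \<Longrightarrow>
      emeasure (M i) {y \<in> space (M i). x(i := y) \<in> E} \<le> c"
  shows "emeasure (PiM I M) E \<le> c"
proof -
  interpret product_sigma_finite M
    using M by (intro product_sigma_finite.intro prob_space_imp_sigma_finite)
  interpret P: prob_space "PiM (I - {i}) M" using M by (rule prob_space_PiM)
  have I': "insert i (I - {i}) = I" using I(2) by auto
  have "emeasure (PiM I M) E = (\<integral>\<^sup>+x. indicator E x \<partial>PiM I M)" using E by simp
  also have "\<dots> = (\<integral>\<^sup>+x. (\<integral>\<^sup>+y. indicator E (x(i := y)) \<partial>M i) \<partial>PiM (I - {i}) M)"
    using product_nn_integral_insert[of "I - {i}" i "indicator E"] I E unfolding I' by simp
  also have "\<dots> \<le> (\<integral>\<^sup>+x. c \<partial>PiM (I - {i}) M)"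
  proof (rule nn_integral_mono)
    fix x assume x: "x \<in> space (PiM (I - {i}) M)"
    have "(\<lambda>y. x(i := y)) \<in> measurable (M i) (PiM (insert i (I - {i})) M)"
      using x by (intro measurable_fun_upd[where J="I - {i}"]) auto
    from measurable_sets[OF this[unfolded I'] E]
    have "{y \<in> space (M i). x(i := y) \<in> E} \<in> sets (M i)"
      by (simp add: vimage_def Int_def conj_commute)
    moreover have "(\<integral>\<^sup>+y. indicator E (x(i := y)) \<partial>M i) =
        (\<integral>\<^sup>+y. indicator {y \<in> space (M i). x(i := y) \<in> E} y \<partial>M i)"
      by (intro nn_integral_cong) (simp add: indicator_def)
    ultimately have "(\<integral>\<^sup>+y. indicator E (x(i := y)) \<partial>M i) = emeasure (M i) {y \<in> space (M i). x(i := y) \<in> E}"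
      by simp
    with fiber[OF x] show "(\<integral>\<^sup>+y. indicator E (x(i := y)) \<partial>M i) \<le> c" by simp
  qed
  also have "\<dots> = c" by (simp add: P.emeasure_space_1)
  finally show ?thesis .
qed

abbreviation uniform_instance :: "nat \<Rightarrow> nat \<Rightarrow> (nat \<Rightarrow> nat \<Rightarrow> real) measure" where
  "uniform_instance n m \<equiv> \<Pi>\<^sub>M i\<in>{..<n}. uniform_sphere m"

lemma space_uniform_instance: "space (uniform_instance n m) = instances n m"
  by (simp add: space_PiM instances_def)

lemma prob_space_uniform_instance: "prob_space (uniform_instance n m)"
  by (rule prob_space_PiM) (rule prob_space_uniform_sphere)

lemma row_dot_measurable:
  "i < n \<Longrightarrow> (\<lambda>A. dot m (A i) g) \<in> borel_measurable (uniform_instance n m)"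
  by (rule measurable_compose[where f="\<lambda>A. A i", OF measurable_component_singleton uniform_sphere_dot_measurable]) simp

lemma sets_row_ge: "i < n \<Longrightarrow> {A \<in> space (uniform_instance n m). c \<le> dot m (A i) g} \<in> sets (uniform_instance n m)"
  using row_dot_measurable[of i n m g] by measurable

lemma sets_row_le: "i < n \<Longrightarrow> {A \<in> space (uniform_instance n m). dot m (A i) g \<le> c} \<in> sets (uniform_instance n m)"
  using row_dot_measurable[of i n m g] by measurable

lemma sets_near_ill_posed:
  assumes "finite G"
  shows "near_ill_posed n m G \<delta> \<in> sets (uniform_instance n m)"
proof -
  have "near_ill_posed n m G \<delta> = {A \<in> space (uniform_instance n m).
     (\<exists>g\<in>G. \<forall>i\<in>{..<n}. - (2 * \<delta>) \<le> dot m (A i) g) \<and> (\<forall>g\<in>G. \<exists>i\<in>{..<n}. dot m (A i) g \<le> \<delta>)}"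
    by (auto simp: near_ill_posed_def space_uniform_instance)
  also have "\<dots> \<in> sets (uniform_instance n m)"
    using assms by (intro sets.sets_Collect_conj sets.sets_Collect_finite_Ex sets.sets_Collect_finite_All'
        sets_row_ge sets_row_le sets.sets_Collect_finite_All) auto
  finally show ?thesis .
qed

text \<open>
  The directions admitted by all rows except the \<open>i\<close>-th. This set must not depend on row \<open>i\<close>, as that row is
  integrated out first.
\<close>

definition admissible :: "nat \<Rightarrow> nat \<Rightarrow> (nat \<Rightarrow> real) set \<Rightarrow> real \<Rightarrow> nat \<Rightarrow> (nat \<Rightarrow> nat \<Rightarrow> real) \<Rightarrow> (nat \<Rightarrow> real) set" where
  "admissible n m G \<delta> i A = {g \<in> G. \<forall>j\<in>{..<n} - {i}. - (2 * \<delta>) \<le> dot m (A j) g}"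

text \<open>
  Row \<open>i\<close> lies in the shell belonging to the directions admitted by the other rows.
\<close>

definition critical_row :: "nat \<Rightarrow> nat \<Rightarrow> (nat \<Rightarrow> real) set \<Rightarrow> real \<Rightarrow> nat \<Rightarrow> (nat \<Rightarrow> nat \<Rightarrow> real) set" where
  "critical_row n m G \<delta> i = {A \<in> instances n m.
     (\<forall>q\<in>admissible n m G \<delta> i A. dot m (A i) q \<le> 4 * real n * \<delta>) \<and>
     (\<exists>p\<in>admissible n m G \<delta> i A. - (2 * \<delta>) \<le> dot m (A i) p)}"

lemma sets_critical_row:
  assumes "finite G" "i < n"
  shows "critical_row n m G \<delta> i \<in> sets (uniform_instance n m)"
proof -
  have "critical_row n m G \<delta> i = {A \<in> space (uniform_instance n m).
     (\<forall>q\<in>G. (\<forall>j\<in>{..<n} - {i}. - (2 * \<delta>) \<le> dot m (A j) q) \<longrightarrow> dot m (A i) q \<le> 4 * real n * \<delta>) \<and>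
     (\<exists>p\<in>G. (\<forall>j\<in>{..<n} - {i}. - (2 * \<delta>) \<le> dot m (A j) p) \<and> - (2 * \<delta>) \<le> dot m (A i) p)}"
    by (auto simp: critical_row_def admissible_def space_uniform_instance)
  also have "\<dots> \<in> sets (uniform_instance n m)"
    using assms by (intro sets.sets_Collect_conj sets.sets_Collect_imp sets.sets_Collect_finite_Ex
        sets_row_ge sets_row_le sets.sets_Collect_finite_All) auto
  finally show ?thesis .
qed

text \<open>
  If the condition fails at every row, pick an admissible \<open>q\<^sub>i\<close> with \<open>\<langle>a\<^sub>i, q\<^sub>i\<rangle> > 4n\<delta>\<close> for each \<open>i\<close> and
  let \<open>s\<close> be their sum. Then \<open>\<langle>a\<^sub>j, s\<rangle> > 4n\<delta> - 2(n - 1)\<delta> > 2n\<delta>\<close> for all \<open>j\<close>, while \<open>\<parallel>s\<parallel> \<le> n\<close>. So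
  the unit vector along \<open>s\<close> is seen above \<open>2\<delta>\<close> by all rows, and a nearby net point above \<open>\<delta>\<close>.
\<close>

lemma near_ill_posed_critical_row:
  assumes A: "A \<in> near_ill_posed n m G \<delta>" and G: "sphere_net m \<delta> G" and \<delta>: "\<delta> > 0" and n: "n > 0"
  shows "\<exists>i<n. A \<in> critical_row n m G \<delta> i"
proof (rule ccontr)
  assume none: "\<not> ?thesis"
  have inst: "A \<in> instances n m" using A by (simp add: near_ill_posed_def)
  then have Ai: "A i \<in> sphere_set m" if "i < n" for i using that by (auto simp: instances_def)
  obtain g where g: "g \<in> G" "\<And>i. i < n \<Longrightarrow> - (2 * \<delta>) \<le> dot m (A i) g"
    using A by (auto simp: near_ill_posed_def)
  have "\<exists>q\<in>admissible n m G \<delta> i A. 4 * real n * \<delta> < dot m (A i) q" if "i < n" for i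
  proof -
    have "g \<in> admissible n m G \<delta> i A" using g by (auto simp: admissible_def)
    moreover have "A \<notin> critical_row n m G \<delta> i" using none that by blast
    ultimately show ?thesis
      unfolding critical_row_def using g(2)[OF that] inst by (auto simp: not_le)
  qed
  then obtain q where q: "\<And>i. i < n \<Longrightarrow> q i \<in> admissible n m G \<delta> i A"
      "\<And>i. i < n \<Longrightarrow> 4 * real n * \<delta> < dot m (A i) (q i)"
    by metis
  have qS: "q i \<in> sphere_set m" if "i < n" for i
    using q(1)[OF that] G by (auto simp: admissible_def sphere_net_def)
  define s where "s = (\<lambda>j. \<Sum>i<n. q i j)"
  have dot_s: "dot m y s = (\<Sum>i<n. dot m y (q i))" for y
    unfolding dot_def s_def sum_distrib_left by (rule sum.swap)
  have big: "2 * real n * \<delta> < dot m (A j) s" if j: "j < n" for j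
  proof -
    have "(\<Sum>i\<in>{..<n} - {j}. - (2 * \<delta>)) \<le> (\<Sum>i\<in>{..<n} - {j}. dot m (A j) (q i))"
      using q(1) j by (intro sum_mono) (auto simp: admissible_def)
    moreover have "(\<Sum>i\<in>{..<n} - {j}. - (2 * \<delta>)) = - (2 * \<delta>) * (real n - 1)"
      using j by (simp add: of_nat_diff)
    moreover have "dot m (A j) s = dot m (A j) (q j) + (\<Sum>i\<in>{..<n} - {j}. dot m (A j) (q i))"
      unfolding dot_s using j by (subst sum.remove[of _ j]) auto
    ultimately show ?thesis using q(2)[OF j] \<delta> by (simp add: algebra_simps)
  qed
  have n\<delta>: "0 < 2 * real n * \<delta>" using n \<delta> by simp
  then have ss: "0 < dot m s s" using big[OF n] by (intro dot_self_pos[of m "A 0"]) auto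
  define u where "u = radial_projection m s"
  have uS: "u \<in> sphere_set m" unfolding u_def by (rule radial_projection_in_sphere[OF ss])
  have dot_u: "dot m y u = dot m y s / sqrt (dot m s s)" for y
    unfolding u_def by (simp add: dot_commute[of m y] dot_radial_projection)
  \<comment> \<open>The norm of \<open>s\<close> is the sum of the inner products \<open>\<langle>q\<^sub>i, u\<rangle> \<le> 1\<close>.\<close>
  have "sqrt (dot m s s) = dot m s u" unfolding dot_u using ss by (simp add: real_div_sqrt)
  also have "\<dots> = (\<Sum>i<n. dot m u (q i))" by (subst dot_commute) (rule dot_s)
  also have "\<dots> \<le> (\<Sum>i<n. 1)"
    using dot_in_cball[OF uS qS] by (intro sum_mono) (auto simp: abs_le_iff)
  finally have norm_s: "sqrt (dot m s s) \<le> real n" by simp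
  obtain g' where g': "g' \<in> G" "\<And>x. x \<in> sphere_set m \<Longrightarrow> \<bar>dot m x u - dot m x g'\<bar> \<le> \<delta>"
    using G uS unfolding sphere_net_def by blast
  have "\<delta> < dot m (A j) g'" if j: "j < n" for j
  proof -
    have "2 * \<delta> * sqrt (dot m s s) \<le> 2 * \<delta> * real n" using norm_s \<delta> by simp
    also have "\<dots> < dot m (A j) s" using big[OF j] by (simp add: mult_ac)
    finally have "2 * \<delta> < dot m (A j) u" unfolding dot_u using ss by (simp add: pos_less_divide_eq)
    then show ?thesis using g'(2)[OF Ai[OF j]] by linarith
  qed
  moreover obtain j where "j < n" "dot m (A j) g' \<le> \<delta>"
    using A g'(1) by (auto simp: near_ill_posed_def)
  ultimately show False by force
qed

lemma emeasure_critical_row_le: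
  assumes G: "sphere_net m \<delta> G" and \<delta>: "\<delta> > 0" and i: "i < n"
  shows "emeasure (uniform_instance n m) (critical_row n m G \<delta> i) \<le> ennreal (72 * real (Suc m) ^ 3 * real n * \<delta>)"
proof (rule emeasure_PiM_fiber_le[OF prob_space_uniform_sphere, of _ i])
  have fin: "finite G" and GS: "G \<subseteq> sphere_set m" using G by (auto simp: sphere_net_def)
  show "critical_row n m G \<delta> i \<in> sets (uniform_instance n m)" using fin i by (rule sets_critical_row)
  fix x
  define P where "P = admissible n m G \<delta> i x"
  have P: "finite P" "P \<subseteq> sphere_set m" using fin GS by (auto simp: P_def admissible_def)
  have "admissible n m G \<delta> i (x(i := y)) = P" for y by (simp add: P_def admissible_def)
  then have "emeasure (uniform_sphere m) {y \<in> space (uniform_sphere m). x(i := y) \<in> critical_row n m G \<delta> i} \<le>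
      emeasure (uniform_sphere m) {y \<in> sphere_set m. (\<forall>q\<in>P. dot m y q \<le> 4 * real n * \<delta>) \<and> (\<exists>p\<in>P. - (2 * \<delta>) \<le> dot m y p)}"
  proof (intro emeasure_mono)
    have "{y \<in> space (uniform_sphere m). (\<forall>q\<in>P. dot m y q \<le> 4 * real n * \<delta>) \<and> (\<exists>p\<in>P. - (2 * \<delta>) \<le> dot m y p)} \<in> sets (uniform_sphere m)"
      using P(1) by measurable
    then show "{y \<in> sphere_set m. (\<forall>q\<in>P. dot m y q \<le> 4 * real n * \<delta>) \<and> (\<exists>p\<in>P. - (2 * \<delta>) \<le> dot m y p)} \<in> sets (uniform_sphere m)"
      by simp
  qed (auto simp: critical_row_def)
  also have "\<dots> \<le> ennreal (12 * real (Suc m) ^ 3 * (4 * real n * \<delta> + 2 * \<delta>))"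
    using \<delta> i by (intro emeasure_shell_le[OF P]) (auto intro: add_nonneg_pos)
  also have "\<dots> \<le> ennreal (72 * real (Suc m) ^ 3 * real n * \<delta>)"
  proof (rule ennreal_leI)
    have "2 * \<delta> \<le> 2 * real n * \<delta>" using \<delta> i by simp
    then have "12 * real (Suc m) ^ 3 * (4 * real n * \<delta> + 2 * \<delta>) \<le> 12 * real (Suc m) ^ 3 * (6 * real n * \<delta>)"
      by (intro mult_left_mono) (linarith, simp)
    also have "12 * real (Suc m) ^ 3 * (6 * real n * \<delta>) = 72 * real (Suc m) ^ 3 * real n * \<delta>" by simp
    finally show "12 * real (Suc m) ^ 3 * (4 * real n * \<delta> + 2 * \<delta>) \<le> 72 * real (Suc m) ^ 3 * real n * \<delta>" .
  qed
  finally show "emeasure (uniform_sphere m) {y \<in> space (uniform_sphere m). x(i := y) \<in> critical_row n m G \<delta> i}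
      \<le> ennreal (72 * real (Suc m) ^ 3 * real n * \<delta>)" .
qed (use i in auto)

lemma emeasure_near_ill_posed_le_polynomial:
  assumes G: "sphere_net m \<delta> G" and \<delta>: "\<delta> > 0" and n: "n > 0"
  shows "emeasure (uniform_instance n m) (near_ill_posed n m G \<delta>) \<le> ennreal (72 * real (Suc m) ^ 3 * real n ^ 2 * \<delta>)"
proof -
  have fin: "finite G" using G by (simp add: sphere_net_def)
  have "emeasure (uniform_instance n m) (near_ill_posed n m G \<delta>) \<le>
      emeasure (uniform_instance n m) (\<Union>i\<in>{..<n}. critical_row n m G \<delta> i)"
    using near_ill_posed_critical_row[OF _ G \<delta> n] fin
    by (intro emeasure_mono sets.finite_UN) (auto intro: sets_critical_row)
  also have "\<dots> \<le> (\<Sum>i\<in>{..<n}. emeasure (uniform_instance n m) (critical_row n m G \<delta> i))"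
    using fin by (intro emeasure_subadditive_finite) (auto intro: sets_critical_row)
  also have "\<dots> \<le> (\<Sum>i\<in>{..<n}. ennreal (72 * real (Suc m) ^ 3 * real n * \<delta>))"
    using emeasure_critical_row_le[OF G \<delta>] by (intro sum_mono) auto
  also have "\<dots> = ennreal (\<Sum>i\<in>{..<n}. 72 * real (Suc m) ^ 3 * real n * \<delta>)"
    using \<delta> by (intro sum_ennreal) auto
  also have "(\<Sum>i\<in>{..<n}. 72 * real (Suc m) ^ 3 * real n * \<delta>) = 72 * real (Suc m) ^ 3 * real n ^ 2 * \<delta>"
    by (simp add: power2_eq_square)
  finally show ?thesis .
qed

text \<open>
  A nearly ill-posed instance has all its rows in one slightly enlarged half-sphere. With \<open>\<beta> = 1 / (96 (m + 1)\<^sup>3)\<close>,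
  the threshold on \<open>\<delta>\<close> gives \<open>2\<delta> + \<beta>/2 \<le> \<beta>\<close>, so that this half-sphere is covered by a cap of height \<open>-\<beta>\<close>
  centred at a point of a second net \<open>H\<close>. The size of \<open>H\<close> depends on \<open>m\<close> only, and each cap contains a
  random row with probability at most \<open>3/4\<close>.
\<close>

lemma emeasure_near_ill_posed_le_exponential:
  assumes G: "sphere_net m \<delta> G" and \<delta>: "\<delta> \<le> 1 / (384 * real (Suc m) ^ 3)"
  shows "emeasure (uniform_instance n m) (near_ill_posed n m G \<delta>) \<le>
    ennreal ((385 * real (Suc m) ^ 4) ^ Suc m * (3 / 4) ^ n)"
proof -
  define \<beta> where "\<beta> = 1 / (96 * real (Suc m) ^ 3)"
  \<comment> \<open>This grid makes the accuracy \<open>(m + 1) / N\<close> equal to \<open>\<beta> / 2\<close>.\<close>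
  define N where "N = 192 * Suc m ^ 4"
  have N: "N > 0" by (simp add: N_def)
  obtain H where H: "sphere_net m (real (Suc m) / real N) H" "card H \<le> (2 * N + 1) ^ Suc m"
    using ex_sphere_net_card_le[OF N] by blast
  have fin: "finite H" and HS: "H \<subseteq> sphere_set m" using H(1) by (auto simp: sphere_net_def)
  have acc: "real (Suc m) / real N = \<beta> / 2"
  proof -
    have "real N = 192 * real (Suc m) ^ 3 * real (Suc m)"
      by (simp only: N_def of_nat_mult of_nat_power of_nat_numeral power3_eq_cube power4_eq_xxxx mult.assoc)
    then show ?thesis by (simp add: \<beta>_def del: of_nat_Suc)
  qed
  have \<delta>\<beta>: "\<delta> \<le> \<beta> / 4" using \<delta> by (simp add: \<beta>_def del: of_nat_Suc)
  interpret product_sigma_finite "\<lambda>_::nat. uniform_sphere m"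
    by (intro product_sigma_finite.intro prob_space_imp_sigma_finite prob_space_uniform_sphere)
  define cap where "cap h = {x \<in> sphere_set m. - \<beta> \<le> dot m x h}" for h
  have cap: "cap h \<in> sets (uniform_sphere m)" for h
  proof -
    have "{x \<in> space (uniform_sphere m). - \<beta> \<le> dot m x h} \<in> sets (uniform_sphere m)" by measurable
    then show ?thesis by (simp add: cap_def)
  qed
  have "near_ill_posed n m G \<delta> \<subseteq> (\<Union>h\<in>H. \<Pi>\<^sub>E i\<in>{..<n}. cap h)"
  proof
    fix A assume A: "A \<in> near_ill_posed n m G \<delta>"
    then obtain g where g: "g \<in> G" "\<And>i. i < n \<Longrightarrow> - (2 * \<delta>) \<le> dot m (A i) g"
      by (auto simp: near_ill_posed_def)
    have Ai: "A \<in> {..<n} \<rightarrow>\<^sub>E sphere_set m" using A by (simp add: near_ill_posed_def instances_def)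
    have "g \<in> sphere_set m" using g(1) G by (auto simp: sphere_net_def)
    then obtain h where h: "h \<in> H" "\<And>x. x \<in> sphere_set m \<Longrightarrow> \<bar>dot m x g - dot m x h\<bar> \<le> \<beta> / 2"
      using H(1) unfolding sphere_net_def acc by blast
    have "A i \<in> cap h" if "i < n" for i
    proof -
      have AiS: "A i \<in> sphere_set m" using Ai that by auto
      moreover have "- \<beta> \<le> dot m (A i) h"
        using h(2)[OF AiS] g(2)[OF that] \<delta>\<beta> by linarith
      ultimately show ?thesis by (simp add: cap_def)
    qed
    then show "A \<in> (\<Union>h\<in>H. \<Pi>\<^sub>E i\<in>{..<n}. cap h)" using h(1) Ai by (auto simp: PiE_iff)
  qed
  then have "emeasure (uniform_instance n m) (near_ill_posed n m G \<delta>) \<le>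
      emeasure (uniform_instance n m) (\<Union>h\<in>H. \<Pi>\<^sub>E i\<in>{..<n}. cap h)"
    using fin cap by (intro emeasure_mono sets.finite_UN sets_PiM_I_finite) auto
  also have "\<dots> \<le> (\<Sum>h\<in>H. emeasure (uniform_instance n m) (\<Pi>\<^sub>E i\<in>{..<n}. cap h))"
    using fin cap by (intro emeasure_subadditive_finite) (auto intro!: sets_PiM_I_finite)
  also have "\<dots> \<le> (\<Sum>h\<in>H. ennreal ((3 / 4) ^ n))"
  proof (rule sum_mono)
    fix h assume "h \<in> H"
    then have "emeasure (uniform_sphere m) (cap h) \<le> ennreal (3 / 4)"
      using emeasure_cap_le[of h m] HS by (auto simp: cap_def \<beta>_def)
    moreover have "emeasure (uniform_instance n m) (\<Pi>\<^sub>E i\<in>{..<n}. cap h) = (\<Prod>i\<in>{..<n}. emeasure (uniform_sphere m) (cap h))"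
      using cap by (intro emeasure_PiM) auto
    ultimately show "emeasure (uniform_instance n m) (\<Pi>\<^sub>E i\<in>{..<n}. cap h) \<le> ennreal ((3 / 4) ^ n)"
      by (simp add: power_mono flip: ennreal_power)
  qed
  also have "\<dots> = ennreal (real (card H) * (3 / 4) ^ n)"
    by (simp add: ennreal_mult ennreal_of_nat_eq_real_of_nat)
  also have "\<dots> \<le> ennreal ((385 * real (Suc m) ^ 4) ^ Suc m * (3 / 4) ^ n)"
  proof (intro ennreal_leI mult_right_mono)
    have "real (card H) \<le> real ((2 * N + 1) ^ Suc m)" using H(2) by (rule of_nat_mono)
    also have "\<dots> = (384 * real (Suc m) ^ 4 + 1) ^ Suc m"
    proof -
      have "2 * N + 1 = 384 * Suc m ^ 4 + 1" by (simp add: N_def)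
      then show ?thesis by (simp only: of_nat_power of_nat_add of_nat_mult of_nat_numeral of_nat_1)
    qed
    also have "\<dots> \<le> (385 * real (Suc m) ^ 4) ^ Suc m"
    proof (rule power_mono)
      have "1 \<le> real (Suc m) ^ 4" by (rule one_le_power) simp
      then show "384 * real (Suc m) ^ 4 + 1 \<le> 385 * real (Suc m) ^ 4" by linarith
    qed simp
    finally show "real (card H) \<le> (385 * real (Suc m) ^ 4) ^ Suc m" .
  qed simp
  finally show ?thesis .
qed

text \<open>
  Beyond the threshold on \<open>\<delta>\<close> the right-hand side exceeds \<open>1\<close>. Below it, for \<open>n \<le> 80 M\<^sup>2\<close> the polynomial bound suffices. For larger \<open>n\<close>, the factor \<open>(385 M\<^sup>4)\<^sup>M \<le> exp (10 M\<^sup>2)\<close> is at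
  most \<open>exp (n / 8)\<close>, so the second bound decays like \<open>exp (-n / 8)\<close>, and multiplying the two
  bounds on \<open>a\<close> cancels the factor \<open>n\<^sup>2\<close>. This yields a bound on \<open>a\<^sup>2\<close>, whence the square root of \<open>\<delta>\<close>.
  The constant is \<open>460800 = 72 \<cdot> 80\<^sup>2\<close>.
\<close>

lemma tail_bounds_combine:
  fixes a \<delta> :: real and M n :: nat
  assumes a: "0 \<le> a" "a \<le> 1" and \<delta>: "0 < \<delta>" and M: "M \<ge> 3"
    and poly: "a \<le> 72 * real M ^ 3 * real n ^ 2 * \<delta>"
    and expo: "\<delta> \<le> 1 / (384 * real M ^ 3) \<Longrightarrow> a \<le> (385 * real M ^ 4) ^ M * (3 / 4) ^ n"
  shows "a \<le> 460800 * real M ^ 7 * sqrt \<delta>"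
proof (cases "\<delta> \<le> 1 / (384 * real M ^ 3)")
  case False
  have M1: "1 \<le> real M" using M by simp
  have "1 / (384 * real M ^ 3) \<le> sqrt \<delta>"
  proof (cases "\<delta> \<le> 1")
    case True
    then have "\<delta>\<^sup>2 \<le> \<delta>" using \<delta> by (simp add: power2_eq_square mult_left_le_one_le)
    then have "\<delta> \<le> sqrt \<delta>" by (rule real_le_rsqrt)
    then show ?thesis using \<open>\<not> \<delta> \<le> _\<close> by linarith
  next
    case False
    have "1 \<le> 384 * real M ^ 3" using one_le_power[OF M1, of 3] by linarith
    then have "1 / (384 * real M ^ 3) \<le> 1" by (subst pos_divide_le_eq) linarith+
    also have "1 \<le> sqrt \<delta>" using False by simp
    finally show ?thesis .
  qed
  then have "460800 * real M ^ 7 * (1 / (384 * real M ^ 3)) \<le> 460800 * real M ^ 7 * sqrt \<delta>"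
    by (intro mult_left_mono) auto
  moreover have "460800 * real M ^ 7 * (1 / (384 * real M ^ 3)) = 1200 * real M ^ 4"
    using M1 by (simp add: field_simps flip: power_add)
  moreover have "1 \<le> real M ^ 4" using M1 by (rule one_le_power)
  ultimately show ?thesis using a(2) by linarith
next
  case True
  have M1: "1 \<le> real M" using M by simp
  have "1 \<le> 384 * real M ^ 3" using one_le_power[OF M1, of 3] by linarith
  then have "1 / (384 * real M ^ 3) \<le> 1" by (subst pos_divide_le_eq) linarith+
  with True have "\<delta> \<le> 1" by linarith
  then have "\<delta>\<^sup>2 \<le> \<delta>" using \<delta> by (simp add: power2_eq_square mult_left_le_one_le)
  then have sq: "\<delta> \<le> sqrt \<delta>" by (rule real_le_rsqrt)
  show ?thesis
  proof (cases "real n \<le> 80 * real M ^ 2")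
    case small: True
    have "real n ^ 2 \<le> (80 * real M ^ 2) ^ 2" using small by (intro power_mono) auto
    then have "72 * real M ^ 3 * real n ^ 2 * \<delta> \<le> 72 * real M ^ 3 * (80 * real M ^ 2) ^ 2 * sqrt \<delta>"
      using sq \<delta> by (intro mult_mono) auto
    also have "\<dots> = 460800 * real M ^ 7 * sqrt \<delta>"
      by (simp add: power_mult_distrib flip: power_mult power_add)
    finally show ?thesis using poly by linarith
  next
    case large: False
    have "385 * real M ^ 4 \<le> (1 + real M) ^ 6 * (1 + real M) ^ 4"
    proof (intro mult_mono power_mono)
      have "(4::real) ^ 6 \<le> (1 + real M) ^ 6" using M by (intro power_mono) auto
      then show "385 \<le> (1 + real M) ^ 6" by simp
    qed auto
    also have "\<dots> = (1 + real M) ^ 10" by (simp flip: power_add)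
    also have "\<dots> \<le> exp (real M) ^ 10" by (intro power_mono exp_ge_add_one_self) auto
    finally have "(385 * real M ^ 4) ^ M \<le> (exp (real M) ^ 10) ^ M" by (intro power_mono) auto
    also have "\<dots> = exp (10 * real M ^ 2)"
      by (simp add: power2_eq_square mult_ac flip: exp_of_nat_mult power_mult)
    also have "\<dots> \<le> exp (real n / 8)" using large by simp
    finally have net: "(385 * real M ^ 4) ^ M \<le> exp (real n / 8)" .
    have "(3 / 4 :: real) \<le> exp (- (1 / 4))" using exp_ge_add_one_self[of "- (1 / 4 :: real)"] by simp
    then have "(3 / 4 :: real) ^ n \<le> exp (- (1 / 4)) ^ n" by (intro power_mono) auto
    also have "\<dots> = exp (- (real n / 4))" by (simp flip: exp_of_nat_mult)
    finally have "a \<le> exp (real n / 8) * exp (- (real n / 4))"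
      using expo[OF True] mult_mono[OF net, of "(3 / 4) ^ n" "exp (- (real n / 4))"] by simp
    also have "\<dots> = exp (- (real n / 8))" by (simp flip: exp_add)
    finally have e: "a \<le> exp (- (real n / 8))" .
    have "real n / 16 \<le> exp (real n / 16)" using exp_ge_add_one_self[of "real n / 16"] by linarith
    then have "(real n / 16) ^ 2 \<le> exp (real n / 16) ^ 2" by (intro power_mono) auto
    also have "\<dots> = exp (real n / 8)" by (simp flip: exp_of_nat_mult)
    finally have "real n ^ 2 * exp (- (real n / 8)) \<le> 256"
      by (simp add: exp_minus field_simps power_divide)
    then have n2: "72 * real M ^ 3 * \<delta> * (real n ^ 2 * exp (- (real n / 8))) \<le> 72 * real M ^ 3 * \<delta> * 256"
      using \<delta> by (intro mult_left_mono) auto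
    have "a\<^sup>2 \<le> (72 * real M ^ 3 * real n ^ 2 * \<delta>) * exp (- (real n / 8))"
      unfolding power2_eq_square[of a] using poly e a order_trans[OF a(1) poly] by (intro mult_mono) auto
    also have "\<dots> \<le> 72 * real M ^ 3 * \<delta> * 256" using n2 by (simp only: mult_ac)
    also have "\<dots> \<le> (460800\<^sup>2 * real M ^ 14) * \<delta>"
    proof -
      have "real M ^ 3 \<le> real M ^ 14" using M1 by (intro power_increasing) auto
      then have "18432 * real M ^ 3 \<le> 460800\<^sup>2 * real M ^ 14" by (intro mult_mono) auto
      from mult_right_mono[OF this, of \<delta>] \<delta> show ?thesis by simp
    qed
    also have "\<dots> = (460800 * real M ^ 7 * sqrt \<delta>)\<^sup>2"
      using \<delta> by (simp add: power_mult_distrib flip: power_mult)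
    finally show ?thesis by (rule power2_le_imp_le) (use \<delta> in auto)
  qed
qed

lemma emeasure_near_ill_posed_le:
  assumes m: "m \<ge> 2" and n: "n > 0" and \<delta>: "\<delta> > 0" and G: "sphere_net m \<delta> G"
  shows "emeasure (uniform_instance n m) (near_ill_posed n m G \<delta>) \<le> ennreal (460800 * real (Suc m) ^ 7 * sqrt \<delta>)"
proof -
  interpret prob_space "uniform_instance n m" by (rule prob_space_uniform_instance)
  have "prob (near_ill_posed n m G \<delta>) \<le> 460800 * real (Suc m) ^ 7 * sqrt \<delta>"
  proof (rule tail_bounds_combine)
    show "prob (near_ill_posed n m G \<delta>) \<le> 72 * real (Suc m) ^ 3 * real n ^ 2 * \<delta>"
      using emeasure_near_ill_posed_le_polynomial[OF G \<delta> n] \<delta>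
      by (simp add: emeasure_eq_measure del: of_nat_Suc)
    show "prob (near_ill_posed n m G \<delta>) \<le> (385 * real (Suc m) ^ 4) ^ Suc m * (3 / 4) ^ n"
      if "\<delta> \<le> 1 / (384 * real (Suc m) ^ 3)"
      using emeasure_near_ill_posed_le_exponential[OF G that, of n]
      by (simp add: emeasure_eq_measure del: of_nat_Suc power_Suc)
  qed (use m \<delta> in auto)
  then show ?thesis by (simp add: emeasure_eq_measure ennreal_leI)
qed

section \<open>The expected logarithm\<close>

lemma e2ennreal_ln_ereal_le:
  assumes "x \<le> ereal r" "r \<ge> 1"
  shows "e2ennreal (ln_ereal x) \<le> ennreal (ln r)"
proof (cases "0 < x")
  case True
  then obtain y where "x = ereal y" "0 < y" "y \<le> r" using assms(1) by (cases x) auto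
  then show ?thesis unfolding ennreal.rep_eq
    by (simp add: ln_ereal_def e2ennreal_ereal ennreal_leI)
qed (auto simp: ln_ereal_def e2ennreal_neg)

text \<open>
  If \<open>k\<close> is the first index beyond \<open>k\<^sub>0\<close> such that the instance is not \<open>4\<^sup>-\<^sup>k\<close>-close to ill-posedness, then
  the log-condition is at most \<open>ln 2 + k ln 4\<close>, and \<open>k - k\<^sub>0\<close> is at most the number of closeness events that
  occur from \<open>k\<^sub>0\<close> on. Starting at \<open>k\<^sub>0\<close> makes the factor \<open>(m + 1)\<^sup>7\<close> of the tail bound disappear, so
  that the expected number of these events is at most \<open>2 \<cdot> 460800\<close>.
\<close>

lemma expectation_log_condition_le:
  assumes m: "m \<ge> 2" and n: "n \<ge> 2" and k0: "real (Suc m) ^ 7 \<le> 2 ^ k0"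
  shows "(\<integral>\<^sup>+ A. e2ennreal (ln_ereal (gcc_condition n m A)) \<partial>uniform_instance n m)
    \<le> ennreal (ln 2 + real k0 * ln 4 + ln 4 * 921600)"
proof -
  interpret prob_space "uniform_instance n m" by (rule prob_space_uniform_instance)
  define d :: "nat \<Rightarrow> real" where "d k = (1 / 4) ^ k" for k
  have d: "0 < d k" "d k \<le> 1" for k by (simp_all add: d_def power_le_one)
  have "\<forall>k. \<exists>G. sphere_net m (d k) G" using ex_sphere_net d(1) by blast
  then obtain G where G: "\<And>k. sphere_net m (d k) (G k)" by metis
  define E where "E k = near_ill_posed n m (G k) (d k)" for k
  have E [measurable]: "E k \<in> sets (uniform_instance n m)" for k
    unfolding E_def using G by (intro sets_near_ill_posed) (simp add: sphere_net_def)
  let ?f = "\<lambda>A. e2ennreal (ln_ereal (gcc_condition n m A))"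
  have f: "?f A \<le> ennreal (ln 2 + real k * ln 4)" if "A \<in> instances n m" "A \<notin> E k" for A k
  proof -
    have "gcc_condition n m A \<le> ereal (2 / d k)"
      using m n that d G by (intro gcc_condition_le) (auto simp: E_def)
    moreover have "1 \<le> 2 / d k" using d[of k] by simp
    moreover have "ln (2 / d k) = ln 2 + real k * ln 4"
      by (simp add: d_def power_divide ln_mult ln_realpow)
    ultimately show ?thesis using e2ennreal_ln_ereal_le by metis
  qed
  have pt: "?f A \<le> ennreal (ln 2 + real k0 * ln 4) + ennreal (ln 4) * (\<Sum>k. indicator (E (k0 + k)) A)"
    if A: "A \<in> instances n m" for A
  proof (cases "\<forall>k. A \<in> E (k0 + k)")
    case True
    then have "(\<Sum>k. indicator (E (k0 + k)) A :: ennreal) = (\<Sum>k. 1)" by (simp add: indicator_def)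
    also have "\<dots> = top" using summable_suminf_not_top[of "\<lambda>_. 1"] by (auto simp: summable_const_iff)
    finally show ?thesis by (simp add: ennreal_mult_top)
  next
    case False
    then obtain k where k: "A \<notin> E (k0 + k)" "\<And>j. j < k \<Longrightarrow> A \<in> E (k0 + j)"
      using exists_least_iff[of "\<lambda>k. A \<notin> E (k0 + k)"] by blast
    have "?f A \<le> ennreal (ln 2 + real (k0 + k) * ln 4)" using f[OF A k(1)] .
    also have "ln 2 + real (k0 + k) * ln 4 = (ln 2 + real k0 * ln 4) + ln 4 * real k"
      by (simp add: algebra_simps)
    also have "ennreal \<dots> = ennreal (ln 2 + real k0 * ln 4) + ennreal (ln 4) * (\<Sum>j<k. indicator (E (k0 + j)) A)"
      using k(2) by (simp add: ennreal_mult ennreal_of_nat_eq_real_of_nat)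
    also have "\<dots> \<le> ennreal (ln 2 + real k0 * ln 4) + ennreal (ln 4) * (\<Sum>k. indicator (E (k0 + k)) A)"
      by (intro add_left_mono mult_left_mono sum_le_suminf) auto
    finally show ?thesis .
  qed
  have tail: "emeasure (uniform_instance n m) (E (k0 + k)) \<le> ennreal (460800 * (1 / 2) ^ k)" for k
  proof -
    have "sqrt (d (k0 + k)) = (1 / 2) ^ (k0 + k)"
      by (simp add: d_def real_sqrt_power real_sqrt_divide)
    then have "emeasure (uniform_instance n m) (E (k0 + k)) \<le> ennreal (460800 * real (Suc m) ^ 7 * (1 / 2) ^ (k0 + k))"
      using emeasure_near_ill_posed_le[OF m _ d(1) G, of n "k0 + k"] n by (simp add: E_def)
    also have "\<dots> \<le> ennreal (460800 * 2 ^ k0 * (1 / 2) ^ (k0 + k))"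
      using k0 by (intro ennreal_leI mult_right_mono mult_left_mono) auto
    also have "460800 * 2 ^ k0 * (1 / 2) ^ (k0 + k) = 460800 * (1 / 2 :: real) ^ k"
      by (simp add: power_add power_divide)
    finally show ?thesis .
  qed
  have "(\<integral>\<^sup>+ A. ?f A \<partial>uniform_instance n m) \<le>
      (\<integral>\<^sup>+ A. ennreal (ln 2 + real k0 * ln 4) + ennreal (ln 4) * (\<Sum>k. indicator (E (k0 + k)) A) \<partial>uniform_instance n m)"
    using pt by (intro nn_integral_mono) (simp add: space_uniform_instance)
  also have "\<dots> = ennreal (ln 2 + real k0 * ln 4) + ennreal (ln 4) * (\<Sum>k. emeasure (uniform_instance n m) (E (k0 + k)))"
    by (simp add: nn_integral_add nn_integral_cmult nn_integral_suminf emeasure_space_1)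
  also have "\<dots> \<le> ennreal (ln 2 + real k0 * ln 4) + ennreal (ln 4) * (\<Sum>k. ennreal (460800 * (1 / 2) ^ k))"
    using tail by (intro add_left_mono mult_left_mono suminf_le) auto
  also have "(\<Sum>k. ennreal (460800 * (1 / 2) ^ k)) = ennreal 921600"
  proof (rule suminf_ennreal_eq)
    show "(\<lambda>k. 460800 * (1 / 2 :: real) ^ k) sums 921600"
      using sums_mult[OF geometric_sums[of "1 / 2 :: real"], of 460800] by simp
  qed simp
  also have "ennreal (ln 2 + real k0 * ln 4) + ennreal (ln 4) * ennreal 921600 = ennreal (ln 2 + real k0 * ln 4 + ln 4 * 921600)"
    by (subst ennreal_mult[symmetric]) (auto simp flip: ennreal_plus)
  finally show ?thesis .
qed

theorem corollary1p3:
  shows "\<exists>K::real. K > 0 \<and>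
    (\<forall>m n :: nat. m \<ge> 2 \<longrightarrow> n > m + 1 \<longrightarrow>
      (\<integral>\<^sup>+ A. e2ennreal (ln_ereal (gcc_condition n m A)) \<partial>(\<Pi>\<^sub>M i\<in>{..<n}. uniform_sphere m))
        \<le> ennreal (K * ln (real m)))"
proof (intro exI[of _ 2000000] conjI allI impI)
  fix m n :: nat assume m: "m \<ge> 2" and n: "n > m + 1"
  \<comment> \<open>The exponent \<open>7 L\<close> is the starting index \<open>k\<^sub>0\<close>, of order \<open>ln m\<close>.\<close>
  define L where "L = nat \<lceil>log 2 (real (Suc m))\<rceil>"
  have log0: "0 \<le> log 2 (real (Suc m))" by simp
  have "2 powr log 2 (real (Suc m)) \<le> 2 powr real L"
    unfolding L_def using log0 by (intro powr_mono real_nat_ceiling_ge) auto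
  then have "real (Suc m) \<le> 2 ^ L" by (simp add: powr_realpow)
  then have "real (Suc m) ^ 7 \<le> (2 ^ L) ^ 7" by (intro power_mono) auto
  also have "\<dots> = 2 ^ (7 * L)" by (simp add: mult.commute flip: power_mult)
  finally have k0: "real (Suc m) ^ 7 \<le> 2 ^ (7 * L)" .
  have ln4: "ln 4 = 2 * ln (2::real)" using ln_realpow[of 2 2] by simp
  have ln2: "ln 2 \<le> ln (real m)" using m by simp
  have "real L \<le> log 2 (real (Suc m)) + 1" unfolding L_def using log0 by linarith
  then have "real L * ln 2 \<le> (log 2 (real (Suc m)) + 1) * ln 2" by (intro mult_right_mono) auto
  also have "\<dots> = ln (real (Suc m)) + ln 2" by (simp add: log_def distrib_right)
  also have "ln (real (Suc m)) \<le> ln (real m ^ 2)"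
  proof -
    have "2 * m \<le> m * m" using m by (intro mult_right_mono) auto
    then have "Suc m \<le> m ^ 2" using m unfolding power2_eq_square by linarith
    then have "real (Suc m) \<le> real m ^ 2" by (metis of_nat_le_iff of_nat_power)
    then show ?thesis by (intro ln_mono) auto
  qed
  also have "ln (real m ^ 2) = 2 * ln (real m)" using m by (simp add: ln_realpow)
  finally have L: "real L * ln 2 \<le> 3 * ln (real m)" using ln2 by linarith
  have "ln 2 + real (7 * L) * ln 4 + ln 4 * 921600 = 14 * (real L * ln 2) + 1843201 * ln 2"
    unfolding ln4 by (simp add: algebra_simps)
  also have "\<dots> \<le> 2000000 * ln (real m)" using L ln2 ln_ge_zero[of "real m"] m by linarith
  finally have "ennreal (ln 2 + real (7 * L) * ln 4 + ln 4 * 921600) \<le> ennreal (2000000 * ln (real m))"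
    by (rule ennreal_leI)
  with expectation_log_condition_le[OF m _ k0, of n] m n
  show "(\<integral>\<^sup>+ A. e2ennreal (ln_ereal (gcc_condition n m A)) \<partial>uniform_instance n m) \<le> ennreal (2000000 * ln (real m))"
    by (meson Suc_leI le_trans less_imp_le_nat add_lessD1 order_trans)
qed simp

end
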